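(* Let $H=H_\omega$ be a weighted analytic Hilbert space and $\varphi\colon\mathbb{D}\to\mathbb{D}$ a symbol for $H$ (i.e. inducing a bounded composition operator $C_\varphi\colon H\to H$) with $\|\varphi\|_\infty<1$. Then $$\limsup_{n\to\infty}[a_n(C_\varphi)]^{1/n}\le \exp\big(-1/\operatorname{Cap}[\overline{\varphi(\mathbb{D})}]\big).$$
   Context: Weighted analytic Hilbert space: $\omega\colon[0,1)\to(0,\infty)$ continuous, positive, integrable, extended radially; $H_\omega$ is the space of analytic $f$ on $\mathbb{D}$ with $\|f\|_\omega^2=|f(0)|^2+\int_{\mathbb{D}}|f'|^2\omega\,dA<\infty$ ($dA$ normalized area measure). $a_n(T)=\inf\{\|T-R\|:\operatorname{rank}R<n\}$. Green capacity: $g(z,w)=\log\left|\frac{1-\bar wz}{z-w}\right|$, $I(\mu)=\iint g\,d\mu\,d\mu$, $V(E)=\inf I(\mu)$ over probability measures supported by a compact subset of $E$, $\operatorname{Cap}(E)=1/V(E)$. *)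

theory Defs
  imports "HOL-Analysis.Analysis" "HOL-Probability.Probability"
begin

text \<open>Admissible weight: continuous, positive, integrable on [0,1); extended radially
  to the disc by omega(z) = omega(|z|).\<close>
definition admissible_weight :: "(real \<Rightarrow> real) \<Rightarrow> bool" where
  "admissible_weight \<omega> \<longleftrightarrow> continuous_on {0..<1} \<omega> \<and> (\<forall>r\<in>{0..<1}. \<omega> r > 0)
      \<and> set_integrable lborel {0..<1} \<omega>"

text \<open>Dirichlet-type integral with normalized area measure dA = dx dy / pi.\<close>
definition dir_integral :: "(real \<Rightarrow> real) \<Rightarrow> (complex \<Rightarrow> complex) \<Rightarrow> ennreal" where
  "dir_integral \<omega> f = (\<integral>\<^sup>+ z. indicator (ball 0 1) z *
       ennreal ((cmod (deriv f z))\<^sup>2 * \<omega> (cmod z) / pi) \<partial>lborel)"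

definition H_space :: "(real \<Rightarrow> real) \<Rightarrow> (complex \<Rightarrow> complex) set" where
  "H_space \<omega> = {f. f holomorphic_on ball 0 1 \<and> dir_integral \<omega> f < \<infinity>}"

definition H_norm :: "(real \<Rightarrow> real) \<Rightarrow> (complex \<Rightarrow> complex) \<Rightarrow> real" where
  "H_norm \<omega> f = sqrt ((cmod (f 0))\<^sup>2 + enn2real (dir_integral \<omega> f))"

definition op_norm :: "(real \<Rightarrow> real) \<Rightarrow> ((complex \<Rightarrow> complex) \<Rightarrow> (complex \<Rightarrow> complex)) \<Rightarrow> real" where
  "op_norm \<omega> T = (SUP f \<in> {f \<in> H_space \<omega>. H_norm \<omega> f \<le> 1}. H_norm \<omega> (T f))"

definition bounded_linear_op :: "(real \<Rightarrow> real) \<Rightarrow> ((complex \<Rightarrow> complex) \<Rightarrow> (complex \<Rightarrow> complex)) \<Rightarrow> bool" where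
  "bounded_linear_op \<omega> T \<longleftrightarrow>
     (\<forall>f \<in> H_space \<omega>. T f \<in> H_space \<omega>)
   \<and> (\<forall>f \<in> H_space \<omega>. \<forall>g \<in> H_space \<omega>. T (\<lambda>z. f z + g z) = (\<lambda>z. T f z + T g z))
   \<and> (\<forall>f \<in> H_space \<omega>. \<forall>c. T (\<lambda>z. c * f z) = (\<lambda>z. c * T f z))
   \<and> (\<exists>M. \<forall>f \<in> H_space \<omega>. H_norm \<omega> (T f) \<le> M * H_norm \<omega> f)"

definition rank_less :: "(real \<Rightarrow> real) \<Rightarrow> ((complex \<Rightarrow> complex) \<Rightarrow> (complex \<Rightarrow> complex)) \<Rightarrow> nat \<Rightarrow> bool" where
  "rank_less \<omega> R n \<longleftrightarrow> (\<exists>gs. length gs < n \<and> set gs \<subseteq> H_space \<omega> \<and>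
       (\<forall>f \<in> H_space \<omega>. \<exists>c. R f = (\<lambda>z. \<Sum>i<length gs. c i * (gs ! i) z)))"

definition approx_number :: "(real \<Rightarrow> real) \<Rightarrow> ((complex \<Rightarrow> complex) \<Rightarrow> (complex \<Rightarrow> complex)) \<Rightarrow> nat \<Rightarrow> real" where
  "approx_number \<omega> T n = Inf {op_norm \<omega> (\<lambda>f z. T f z - R f z) | R.
       bounded_linear_op \<omega> R \<and> rank_less \<omega> R n}"

definition comp_op :: "(complex \<Rightarrow> complex) \<Rightarrow> (complex \<Rightarrow> complex) \<Rightarrow> (complex \<Rightarrow> complex)" where
  "comp_op \<phi> f = f \<circ> \<phi>"

definition green :: "complex \<Rightarrow> complex \<Rightarrow> ennreal" where
  "green z w = (if z = w then \<infinity> else ennreal (ln (cmod ((1 - cnj w * z) / (z - w)))))"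

definition green_energy :: "complex measure \<Rightarrow> ennreal" where
  "green_energy \<mu> = (\<integral>\<^sup>+ z. (\<integral>\<^sup>+ w. green z w \<partial>\<mu>) \<partial>\<mu>)"

definition green_V :: "complex set \<Rightarrow> ennreal" where
  "green_V E = (INF \<mu> \<in> {\<mu>. prob_space \<mu> \<and> sets \<mu> = sets (borel :: complex measure) \<and>
        (\<exists>K. compact K \<and> K \<subseteq> E \<and> emeasure \<mu> (UNIV - K) = 0)}. green_energy \<mu>)"

definition green_cap :: "complex set \<Rightarrow> ennreal" where
  "green_cap E = inverse (green_V E)"

text \<open>exp(-1/Cap E), with the conventions 1/0 = infinity, exp(-infinity) = 0.\<close>
definition exp_neg_inv_cap :: "complex set \<Rightarrow> real" where
  "exp_neg_inv_cap E = (if inverse (green_cap E) = \<infinity> then 0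
                        else exp (- enn2real (inverse (green_cap E))))"

end

theory Submission
  imports Defs "HOL-Complex_Analysis.Complex_Analysis"
begin

text \<open>
  Let \<open>K\<close> be the closure of the image and \<open>\<rho>\<close> the pseudo-hyperbolic distance, so that the Green
  function is \<open>-ln \<rho>\<close>. Suppose that every finite Blaschke product with \<open>m\<close> zeros in \<open>K\<close> has modulus
  at least \<open>exp (- m c)\<close> somewhere on \<open>K\<close>. Choosing points greedily gives a sequence whose empirical
  measures have truncated Green energy at most \<open>c + o(1)\<close>; a weak limit is a probability measure
  on \<open>K\<close> of energy at most \<open>c\<close>. Hence for \<open>c < V(K)\<close> some Blaschke product \<open>B\<close> of degree \<open>m\<close>
  satisfies \<open>|B| < exp (- m c)\<close> on \<open>K\<close>.

  Replace \<open>B\<close> by the corresponding product for a disc of radius \<open>s < 1\<close> close to 1. Interpolating \<open>f\<close>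
  at the zeros of \<open>B ^ k\<close> by means of the Cauchy integral over \<open>|\<zeta>| = s\<close> is an operator of rank \<open>k m\<close>,
  and the error is \<open>B ^ k\<close> times a Cauchy integral of \<open>f / B ^ k\<close>, where \<open>|B| = 1\<close> on the circle.
  Composed with the symbol, the error has norm at most a constant times \<open>exp (- k m c)\<close>.
\<close>

section \<open>Invariance of area measure and mean value inequalities\<close>

text \<open>The weight is arbitrary near the boundary, so a function of the space is known only
  through interior estimates: the area mean inequality for the square of \<open>deriv f\<close>
  bounds \<open>deriv f\<close>, hence \<open>f\<close>, on smaller discs. The norm involves
  derivatives, so the interpolation error must be small on a neighbourhood of the image and not only
  on the image; Cauchy's inequality and the chain rule then give the norm after composition, because
  \<phi> itself lies in the space as the image of the identity function.

  An empirical measure has infinite Green energy, since each point mass interacts with itself.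
  Truncating the kernel at height M bounds each diagonal term by M, a total of M / n after
  normalisation, which vanishes as n grows with M fixed; M is sent to infinity afterwards.

  The degree m and the radius s are fixed before k grows, so all constants are independent of k, and
  an n between consecutive multiples of m costs only a bounded factor.\<close>

lemma nn_integral_lborel_translate:
  fixes f :: "'a::euclidean_space \<Rightarrow> ennreal"
  assumes [measurable]: "f \<in> borel_measurable borel"
  shows "(\<integral>\<^sup>+ x. f (a + x) \<partial>lborel) = (\<integral>\<^sup>+ x. f x \<partial>lborel)"
proof -
  have "(\<integral>\<^sup>+ x. f x \<partial>lborel) = (\<integral>\<^sup>+ x. f x \<partial>distr lborel borel ((+) a))"
    by (simp add: lborel_distr_plus)
  also have "\<dots> = (\<integral>\<^sup>+ x. f (a + x) \<partial>lborel)"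
    by (rule nn_integral_distr) auto
  finally show ?thesis by simp
qed

lemma nn_integral_lborel_reflect:
  fixes f :: "'a::euclidean_space \<Rightarrow> ennreal"
  assumes [measurable]: "f \<in> borel_measurable borel"
  shows "(\<integral>\<^sup>+ x. f (a - x) \<partial>lborel) = (\<integral>\<^sup>+ x. f x \<partial>lborel)"
proof -
  have "lborel = distr lborel borel (\<lambda>x::'a. a + (-1) *\<^sub>R x)"
    using lborel_affine[of "-1" a] by (simp add: density_1)
  then have "(\<integral>\<^sup>+ x. f x \<partial>lborel) = (\<integral>\<^sup>+ x. f x \<partial>distr lborel borel (\<lambda>x::'a. a + (-1) *\<^sub>R x))"
    by simp
  also have "\<dots> = (\<integral>\<^sup>+ x. f (a - x) \<partial>lborel)"
    by (subst nn_integral_distr) auto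
  finally show ?thesis by simp
qed

text \<open>Uniqueness of Haar measure by Fubini: the double integral of
  \<open>indicator A x * indicator B (x + y)\<close> is computed once directly and once after the
  shift of x by y that invariance of M permits.\<close>

lemma translation_invariant_proportional_lborel:
  fixes M :: "'a::euclidean_space measure"
  assumes "sigma_finite_measure M" and sM: "sets M = sets borel"
    and inv: "\<And>f a. f \<in> borel_measurable borel \<Longrightarrow> (\<integral>\<^sup>+ x. f (x + a) \<partial>M) = (\<integral>\<^sup>+ x. f x \<partial>M)"
    and [measurable]: "A \<in> sets borel" "B \<in> sets borel"
  shows "emeasure M A * emeasure lborel B = emeasure M B * emeasure lborel A"
proof -
  interpret M: sigma_finite_measure M by fact
  interpret P: pair_sigma_finite M lborel
    by (simp add: pair_sigma_finite_def assms sigma_finite_lborel)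
  note [measurable_cong] = sM
  have "emeasure M A * emeasure lborel B = (\<integral>\<^sup>+x. indicator A x * emeasure lborel B \<partial>M)"
    using sM by (simp add: nn_integral_multc)
  also have "\<dots> = (\<integral>\<^sup>+x. (\<integral>\<^sup>+y. indicator A x * indicator B (x + y) \<partial>lborel) \<partial>M)"
    by (simp add: nn_integral_cmult nn_integral_lborel_translate)
  also have "\<dots> = (\<integral>\<^sup>+y. (\<integral>\<^sup>+x. indicator A x * indicator B (x + y) \<partial>M) \<partial>lborel)"
    by (rule P.Fubini'[symmetric]) measurable
  also have "\<dots> = (\<integral>\<^sup>+y. (\<integral>\<^sup>+x. indicator A (x - y) * indicator B x \<partial>M) \<partial>lborel)"
  proof (rule nn_integral_cong)
    fix y :: 'a
    show "(\<integral>\<^sup>+x. indicator A x * indicator B (x + y) \<partial>M) = (\<integral>\<^sup>+x. indicator A (x - y) * indicator B x \<partial>M)"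
      using inv[of "\<lambda>x. indicator A (x - y) * indicator B x" y] by simp
  qed
  also have "\<dots> = (\<integral>\<^sup>+x. (\<integral>\<^sup>+y. indicator A (x - y) * indicator B x \<partial>lborel) \<partial>M)"
    by (rule P.Fubini') measurable
  also have "\<dots> = (\<integral>\<^sup>+x. emeasure lborel A * indicator B x \<partial>M)"
    by (simp add: nn_integral_multc nn_integral_lborel_reflect)
  also have "\<dots> = emeasure M B * emeasure lborel A"
    using sM by (subst nn_integral_cmult) (auto simp: mult.commute)
  finally show ?thesis .
qed

text \<open>The image of Lebesgue measure under a rotation is again translation invariant, hence
  proportional to it. The unit ball is mapped to itself and has measure pi, so the factor is
  1.\<close>

lemma nn_integral_lborel_rotate:
  fixes c :: complex and f :: "complex \<Rightarrow> ennreal"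
  assumes c: "cmod c = 1" and [measurable]: "f \<in> borel_measurable borel"
  shows "(\<integral>\<^sup>+ x. f (c * x) \<partial>lborel) = (\<integral>\<^sup>+ x. f x \<partial>lborel)"
proof -
  let ?M = "distr lborel borel ((*) c)"
  have vim: "(*) c -` ball 0 r = ball 0 r" for r using c by (auto simp: norm_mult)
  have sf: "sigma_finite_measure ?M"
  proof
    show "\<exists>A. countable A \<and> A \<subseteq> sets ?M \<and> \<Union> A = space ?M \<and> (\<forall>a\<in>A. emeasure ?M a \<noteq> \<infinity>)"
    proof (intro exI[of _ "range (\<lambda>n::nat. ball 0 (real n))"] conjI ballI)
      show "\<Union> (range (\<lambda>n::nat. ball 0 (real n))) = space ?M"
        using reals_Archimedean2 by auto
      fix a assume "a \<in> range (\<lambda>n::nat. ball (0::complex) (real n))"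
      then obtain n where "a = ball 0 (real n)" by auto
      then show "emeasure ?M a \<noteq> \<infinity>"
        using emeasure_lborel_ball_finite[of "0::complex" "real n"]
        by (auto simp: emeasure_distr vim)
    qed auto
  qed
  have inv: "(\<integral>\<^sup>+ x. g (x + a) \<partial>?M) = (\<integral>\<^sup>+ x. g x \<partial>?M)"
    if [measurable]: "g \<in> borel_measurable borel" for g :: "complex \<Rightarrow> ennreal" and a
  proof -
    have c0: "c \<noteq> 0" using c by auto
    have "(\<integral>\<^sup>+ x. g (x + a) \<partial>?M) = (\<integral>\<^sup>+ x. g (c * (a / c + x)) \<partial>lborel)"
      using c0 by (subst nn_integral_distr) (auto simp: distrib_left add.commute)
    also have "\<dots> = (\<integral>\<^sup>+ x. g (c * x) \<partial>lborel)"
      by (rule nn_integral_lborel_translate[of "\<lambda>x. g (c * x)"]) measurable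
    finally show ?thesis by (simp add: nn_integral_distr)
  qed
  have "?M = lborel"
  proof (rule measure_eqI)
    fix A assume "A \<in> sets ?M"
    then have [measurable]: "A \<in> sets borel" by simp
    have "emeasure ?M A * emeasure lborel (ball (0::complex) 1) = emeasure ?M (ball 0 1) * emeasure lborel A"
      by (rule translation_invariant_proportional_lborel[OF sf _ inv]) auto
    also have "emeasure ?M (ball 0 1) = emeasure lborel (ball (0::complex) 1)"
      by (simp add: emeasure_distr vim)
    finally have "emeasure lborel (ball (0::complex) 1) * emeasure ?M A
        = emeasure lborel (ball (0::complex) 1) * emeasure lborel A"
      by (simp only: mult.commute[of "emeasure ?M A"])
    moreover have "emeasure lborel (ball (0::complex) 1) = ennreal pi"
      by (simp add: emeasure_ball unit_ball_vol_2)
    ultimately show "emeasure ?M A = emeasure lborel A"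
      by (simp add: ennreal_mult_cancel_left)
  qed simp
  then have "(\<integral>\<^sup>+ x. f x \<partial>lborel) = (\<integral>\<^sup>+ x. f x \<partial>?M)" by simp
  then show ?thesis by (simp add: nn_integral_distr)
qed

section \<open>Mean values of holomorphic functions over circles and discs\<close>

text \<open>Cauchy's formula at the centre of the unit circle, for u -> h (z + u w). The point w is
  kept instead of a radius, and the mean is a nonnegative integral, so that w can later be
  integrated over a disc by Fubini.\<close>

lemma holomorphic_circle_mean_ineq:
  assumes h: "h holomorphic_on ball z R" and w: "cmod w < R"
  shows "ennreal (cmod (h z)) \<le> (\<integral>\<^sup>+ t. indicator {0..1} t * ennreal (cmod (h (z + exp (2 * pi * \<i> * of_real t) * w))) \<partial>lborel)"
proof -
  define g where "g u = h (z + u * w)" for u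
  have wb: "cmod (u * w) < R" if "cmod u \<le> 1" for u
    using that w mult_right_mono[of "cmod u" 1 "cmod w"] by (simp add: norm_mult)
  have gc: "continuous_on (cball 0 1) g"
    unfolding g_def using wb
    by (intro continuous_on_compose2[OF holomorphic_on_imp_continuous_on[OF h]] continuous_intros)
       (auto simp: dist_norm)
  have gh: "g holomorphic_on ball 0 1"
    unfolding g_def using wb
    by (intro holomorphic_on_compose_gen[OF _ h, unfolded o_def] holomorphic_intros)
       (auto simp: dist_norm less_imp_le)
  have "((\<lambda>u. g u / (u - 0)) has_contour_integral (2 * of_real pi * \<i> * g 0)) (circlepath 0 1)"
    by (rule Cauchy_integral_circlepath[OF gc gh]) auto
  moreover have "circlepath 0 1 t = exp (2 * pi * \<i> * of_real t)" for t
    by (simp add: circlepath mult_ac)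
  ultimately have "((\<lambda>t. 2 * of_real pi * \<i> * g (exp (2 * pi * \<i> * of_real t))) has_integral 2 * of_real pi * \<i> * g 0) {0..1}"
    unfolding has_contour_integral
    by (elim has_integral_eq[rotated]) (simp add: vector_derivative_circlepath)
  from has_integral_mult_right[OF this, of "1 / (2 * of_real pi * \<i>)"]
  have I: "((\<lambda>t. g (exp (2 * pi * \<i> * of_real t))) has_integral g 0) {0..1}"
    by simp
  have cont: "continuous_on {0..1} (\<lambda>t::real. g (exp (2 * pi * \<i> * of_real t)))"
    by (intro continuous_on_compose2[OF gc] continuous_intros) auto
  have "cmod (g 0) = cmod (integral {0..1} (\<lambda>t. g (exp (2 * pi * \<i> * of_real t))))"
    using I by (simp add: integral_unique)
  also have "\<dots> \<le> integral {0..1} (\<lambda>t. cmod (g (exp (2 * pi * \<i> * of_real t))))"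
    using cont by (intro integral_norm_bound_integral integrable_continuous_interval continuous_intros) auto
  finally have "cmod (g 0) \<le> integral {0..1} (\<lambda>t. cmod (g (exp (2 * pi * \<i> * of_real t))))" .
  moreover have "(\<integral>\<^sup>+ t. indicator {0..1} t * ennreal (cmod (g (exp (2 * pi * \<i> * of_real t)))) \<partial>lborel)
     = ennreal (integral {0..1} (\<lambda>t. cmod (g (exp (2 * pi * \<i> * of_real t)))))"
  proof -
    let ?f = "\<lambda>t. cmod (g (exp (2 * pi * \<i> * of_real t)))"
    have c: "continuous_on {0..1} ?f" by (intro continuous_intros cont)
    have "(\<integral>\<^sup>+ t. ennreal (indicator {0..1} t *\<^sub>R ?f t) \<partial>lborel) = ennreal (integral {0..1} ?f)"
    proof (rule nn_integral_has_integral_lborel)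
      show "(\<lambda>t. indicator {0..1} t *\<^sub>R ?f t) \<in> borel_measurable borel"
        by (intro borel_measurable_continuous_on_indicator c) auto
      have "(?f has_integral integral {0..1} ?f) {0..1}"
        by (intro integrable_integral integrable_continuous_interval c)
      then have "((\<lambda>t. if t \<in> {0..1} then ?f t else 0) has_integral integral {0..1} ?f) UNIV"
        by (simp only: has_integral_restrict_UNIV)
      then show "((\<lambda>t. indicator {0..1} t *\<^sub>R ?f t) has_integral integral {0..1} ?f) UNIV"
        by (rule has_integral_eq[rotated]) auto
    qed auto
    then show ?thesis by (simp add: ennreal_mult' ennreal_indicator)
  qed
  ultimately show ?thesis unfolding g_def by (simp add: ennreal_leI)
qed

text \<open>The circle inequality is integrated over w in the disc. After the exchange of integrals,
  rotation and translation invariance make the inner integral the same for every t; this takes the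
  place of polar coordinates.\<close>

lemma holomorphic_area_mean_ineq:
  assumes h: "h holomorphic_on ball z R" and d: "0 < d" "d \<le> R"
  shows "ennreal (cmod (h z)) * emeasure lborel (ball (0::complex) d)
      \<le> (\<integral>\<^sup>+ w. indicator (ball z d) w * ennreal (cmod (h w)) \<partial>lborel)"
proof -
  define F where "F w = indicator (ball z d) w * ennreal (cmod (h w))" for w
  have "continuous_on (ball z d) (\<lambda>w. cmod (h w))"
    using h d by (intro continuous_intros holomorphic_on_imp_continuous_on) (auto elim: holomorphic_on_subset)
  then have "(\<lambda>w. indicator (ball z d) w *\<^sub>R cmod (h w)) \<in> borel_measurable borel"
    by (intro borel_measurable_continuous_on_indicator) auto
  then have "(\<lambda>w. ennreal (indicator (ball z d) w *\<^sub>R cmod (h w))) \<in> borel_measurable borel"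
    by measurable
  then have [measurable]: "F \<in> borel_measurable borel"
    unfolding F_def by (simp add: ennreal_mult' ennreal_indicator)
  let ?e = "\<lambda>t::real. exp (2 * pi * \<i> * of_real t)"
  have Fe: "F (z + ?e t * w) = indicator (ball 0 d) w * ennreal (cmod (h (z + ?e t * w)))" for t w
    by (auto simp: F_def indicator_def dist_norm norm_mult)
  have "ennreal (cmod (h z)) * emeasure lborel (ball (0::complex) d)
     = (\<integral>\<^sup>+ w. ennreal (cmod (h z)) * indicator (ball (0::complex) d) w \<partial>lborel)"
    by (simp add: nn_integral_cmult_indicator)
  also have "\<dots> \<le> (\<integral>\<^sup>+ w. (\<integral>\<^sup>+ t. indicator {0..1} t * F (z + ?e t * w) \<partial>lborel) \<partial>lborel)"
  proof (rule nn_integral_mono)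
    fix w :: complex
    show "ennreal (cmod (h z)) * indicator (ball 0 d) w \<le> (\<integral>\<^sup>+ t. indicator {0..1} t * F (z + ?e t * w) \<partial>lborel)"
      unfolding Fe using holomorphic_circle_mean_ineq[OF h, of w] d
      by (cases "w \<in> ball 0 d") auto
  qed
  also have "\<dots> = (\<integral>\<^sup>+ t. (\<integral>\<^sup>+ w. indicator {0..1} t * F (z + ?e t * w) \<partial>lborel) \<partial>lborel)"
    by (rule lborel_pair.Fubini') measurable
  also have "\<dots> = (\<integral>\<^sup>+ t. indicator {0..1} t * (\<integral>\<^sup>+ w. F w \<partial>lborel) \<partial>(lborel::real measure))"
  proof (rule nn_integral_cong)
    fix t :: real
    have "(\<integral>\<^sup>+ w. F (z + ?e t * w) \<partial>lborel) = (\<integral>\<^sup>+ w. F (z + w) \<partial>lborel)"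
      by (rule nn_integral_lborel_rotate[of _ "\<lambda>w. F (z + w)"]) auto
    also have "\<dots> = (\<integral>\<^sup>+ w. F w \<partial>lborel)" by (rule nn_integral_lborel_translate) measurable
    finally show "(\<integral>\<^sup>+ w. indicator {0..1} t * F (z + ?e t * w) \<partial>lborel) = indicator {0..1} t * (\<integral>\<^sup>+ w. F w \<partial>lborel)"
      by (simp add: nn_integral_cmult)
  qed
  also have "\<dots> = (\<integral>\<^sup>+ w. F w \<partial>lborel)"
    by (simp add: nn_integral_multc)
  finally show ?thesis by (simp add: F_def)
qed

text \<open>Comparing the masses of half-lines suffices, and these correspond to annuli. The result
  turns the integral of a radial weight over the disc into one over [0, 1), where integrability of
  \<omega> is assumed.\<close>

lemma distr_lborel_cmod_ball:
  "distr (restrict_space lborel (ball 0 1)) borel cmod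
   = density lborel (\<lambda>r. ennreal (indicator {0..<1} r * (2 * pi * r)))" (is "?M = ?N")
proof (rule measure_eqI_lessThan)
  fix x :: real
  have I: "(\<integral>\<^sup>+ r. ennreal (2 * pi * r) * indicator {a..1} r \<partial>lborel) = ennreal (pi - pi * a\<^sup>2)"
    if "0 \<le> a" "a \<le> 1" for a :: real
  proof -
    have "((\<lambda>r. pi * r\<^sup>2) has_real_derivative 2 * pi * y) (at y)" for y
      by (auto intro!: derivative_eq_intros)
    then show ?thesis
      using nn_integral_FTC_Icc[of "\<lambda>r. 2 * pi * r" a 1 "\<lambda>r. pi * r\<^sup>2"] that by simp
  qed
  have AE1: "AE r in (lborel::real measure). r \<noteq> 1" by (rule AE_lborel_singleton)
  have B: "emeasure lborel (cball (0::complex) a) = ennreal (pi * a\<^sup>2)" if "0 \<le> a" for a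
    using that by (simp add: emeasure_cball unit_ball_vol_2)
  have U: "emeasure lborel (ball (0::complex) 1) = ennreal pi"
    by (simp add: emeasure_ball unit_ball_vol_2)
  have "emeasure ?M {x<..} = emeasure lborel (ball 0 1 \<inter> {z. x < cmod z})"
    by (subst emeasure_distr)
       (auto simp: emeasure_restrict_space space_restrict_space measurable_restrict_space1
         intro!: arg_cong[where f="emeasure lborel"])
  \<comment> \<open>\<open>min 1 (max 0 x)\<close> is the inner radius of the annulus: for x < 0 the
    whole disc is counted, for x > 1 nothing.\<close>
  also have "\<dots> = ennreal (pi - pi * (min 1 (max 0 x))\<^sup>2)"
  proof (cases "x < 0"; cases "x \<le> 1")
    assume "x < 0"
    then have "ball 0 1 \<inter> {z. x < cmod z} = ball 0 1" by (auto intro: less_le_trans)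
    with U \<open>x < 0\<close> show ?thesis by simp
  next
    assume x: "\<not> x < 0" "x \<le> 1"
    show ?thesis
    proof (cases "x = 1")
      case True
      then have "ball 0 1 \<inter> {z. x < cmod z} = {}" by auto
      with True show ?thesis by simp
    next
      case False
      have "ball 0 1 \<inter> {z. x < cmod z} = ball 0 1 - cball 0 x" by auto
      moreover have "emeasure lborel (ball 0 1 - cball (0::complex) x)
          = emeasure lborel (ball (0::complex) 1) - emeasure lborel (cball (0::complex) x)"
        using x False by (intro emeasure_Diff) (auto simp: B)
      ultimately show ?thesis using x by (simp add: U B ennreal_minus)
    qed
  next
    assume x: "\<not> x < 0" "\<not> x \<le> 1"
    then have "ball 0 1 \<inter> {z. x < cmod z} = {}" by auto
    with x show ?thesis by simp
  qed simp
  also have "\<dots> = (\<integral>\<^sup>+ r. ennreal (2 * pi * r) * indicator {min 1 (max 0 x)..1} r \<partial>lborel)"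
    by (rule I[symmetric]) auto
  also have "\<dots> = emeasure ?N {x<..}"
  proof -
    \<comment> \<open>The two integrands differ at most at r = 1 and r = x.\<close>
    have "AE r in lborel. ennreal (2 * pi * r) * indicator {min 1 (max 0 x)..1} r
       = ennreal (indicator {0..<1} r * (2 * pi * r)) * indicator {x<..} r"
      using AE1 AE_lborel_singleton[of x] by eventually_elim (auto simp: indicator_def)
    then show ?thesis by (subst emeasure_density) (auto intro!: nn_integral_cong_AE)
  qed
  finally show "emeasure ?M {x<..} = emeasure ?N {x<..}" .
  show "emeasure ?M {x<..} < \<infinity>"
    unfolding \<open>emeasure ?M {x<..} = emeasure lborel (ball 0 1 \<inter> {z. x < cmod z})\<close>
    by (rule le_less_trans[OF emeasure_mono, of _ "ball 0 1"]) (auto simp: U)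
qed auto

section \<open>A space-filling curve\<close>

text \<open>An even wave of period 2 with value 0 on [0, 1/3] and 1 on [2/3, 1]: the clipping
  produces these plateaus because cos (pi/3) = 1/2 and cos (2 pi/3) = -1/2.\<close>

definition fold_wave :: "real \<Rightarrow> real" where
  "fold_wave t = min 1 (max 0 (1 / 2 - cos (pi * t)))"

text \<open>Schoenberg's space-filling curve. On the Cantor set, the ternary digits of even index
  become the binary digits of the real part, those of odd index the binary digits of the imaginary
  part.\<close>

definition schoenberg :: "real \<Rightarrow> complex" where
  "schoenberg t = Complex (\<Sum>n. fold_wave (3 ^ (2 * n) * t) / 2 ^ Suc n)
                          (\<Sum>n. fold_wave (3 ^ (2 * n + 1) * t) / 2 ^ Suc n)"

lemma fold_wave_bounds: "0 \<le> fold_wave t" "fold_wave t \<le> 1"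
  by (auto simp: fold_wave_def)

lemma continuous_on_fold_wave_series:
  fixes k :: "nat \<Rightarrow> real"
  shows "continuous_on UNIV (\<lambda>t. \<Sum>n. fold_wave (k n * t) / 2 ^ Suc n)"
proof (rule uniform_limit_theorem[where F=sequentially])
  show "\<forall>\<^sub>F n in sequentially. continuous_on UNIV (\<lambda>t. \<Sum>i<n. fold_wave (k i * t) / 2 ^ Suc i)"
    unfolding fold_wave_def by (intro always_eventually allI continuous_intros) auto
  have "summable (\<lambda>n. (1 / 2) ^ Suc n :: real)"
    by (subst summable_Suc_iff) (auto intro: summable_geometric)
  then show "uniform_limit UNIV (\<lambda>n t. \<Sum>i<n. fold_wave (k i * t) / 2 ^ Suc i) (\<lambda>t. \<Sum>n. fold_wave (k n * t) / 2 ^ Suc n) sequentially"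
    using fold_wave_bounds by (intro Weierstrass_m_test[where M="\<lambda>n. (1 / 2) ^ Suc n"]) (auto simp: power_divide divide_right_mono)
qed auto

lemma continuous_on_schoenberg: "continuous_on UNIV schoenberg"
  unfolding schoenberg_def
  by (intro continuous_intros continuous_on_fold_wave_series)

text \<open>The doubling map produces the digits: its orbit \<open>X\<close> stays in [0, 1], and
  the first n digits approximate x with error exactly \<open>X n / 2 ^ n\<close>.\<close>

lemma binary_expansion_exists:
  fixes x :: real
  assumes "0 \<le> x" "x \<le> 1"
  shows "\<exists>c :: nat \<Rightarrow> bool. (\<lambda>n. of_bool (c n) / 2 ^ Suc n) sums x"
proof -
  define X where "X = rec_nat x (\<lambda>_ y. if 1 / 2 \<le> y then 2 * y - 1 else 2 * y)"
  define c where "c n \<longleftrightarrow> 1 / 2 \<le> X n" for n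
  have X0: "X 0 = x" and XS: "X (Suc n) = 2 * X n - of_bool (c n)" for n
    by (auto simp: X_def c_def)
  have Xb: "0 \<le> X n \<and> X n \<le> 1" for n
    by (induction n) (use assms in \<open>auto simp: X0 XS c_def\<close>)
  have part: "(\<Sum>i<n. of_bool (c i) / 2 ^ Suc i) = x - X n / 2 ^ n" for n
    by (induction n) (auto simp: X0 XS field_simps)
  have "(\<lambda>n. X n * (1 / 2) ^ n) \<longlonglongrightarrow> 0"
  proof (rule tendsto_sandwich[OF _ _ tendsto_const])
    show "\<forall>\<^sub>F n in sequentially. 0 \<le> X n * (1 / 2) ^ n" using Xb by auto
    show "\<forall>\<^sub>F n in sequentially. X n * (1 / 2) ^ n \<le> (1 / 2) ^ n"
      using Xb mult_right_mono[of "X _" 1 "(1 / 2) ^ _"] by auto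
    show "(\<lambda>n. (1 / 2) ^ n :: real) \<longlonglongrightarrow> 0" by (rule LIMSEQ_power_zero) auto
  qed
  then have "(\<lambda>n. x - X n / 2 ^ n) \<longlonglongrightarrow> x - 0"
    by (intro tendsto_diff tendsto_const) (simp add: power_divide)
  then show ?thesis unfolding sums_def by (intro exI[of _ c]) (simp only: part diff_zero)
qed

text \<open>Multiplication by \<open>3 ^ k\<close> turns the digits before index k into an even
  integer, because each is 0 or 2, and the wave has period 2. What remains is r / 3 or (r + 2) / 3
  with r in [0, 1], which lies on the plateau selected by digit k.\<close>

lemma fold_wave_ternary_digit:
  fixes c :: "nat \<Rightarrow> bool"
  defines "t \<equiv> \<Sum>n. 2 * of_bool (c n) / 3 ^ Suc n"
  shows "fold_wave (3 ^ k * t) = of_bool (c k)"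
proof -
  define a :: "nat \<Rightarrow> real" where "a n = 2 * of_bool (c n) / 3 ^ Suc n" for n
  have geo: "(\<lambda>n. (2 / 3) * (1 / 3) ^ n :: real) sums ((2 / 3) * (1 / (1 - 1 / 3)))"
    by (intro sums_mult geometric_sums) auto
  have summ: "summable (\<lambda>n. a (n + j))" for j
    by (subst summable_iff_shift, rule summable_comparison_test'[OF sums_summable[OF geo], of 0])
       (auto simp: a_def power_divide)
  \<comment> \<open>The rescaled tail after digit k; it is at most 1 by comparison with the series
    in which every digit is 2.\<close>
  define r where "r = 3 ^ Suc k * (\<Sum>n. a (n + Suc k))"
  have r0: "0 \<le> r" unfolding r_def by (intro mult_nonneg_nonneg suminf_nonneg summ) (auto simp: a_def)
  have "(\<lambda>n. 3 ^ Suc k * a (n + Suc k)) sums r"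
    unfolding r_def by (intro sums_mult summable_sums summ)
  then have r1: "r \<le> 1"
    using sums_le[OF _ _ geo, of "\<lambda>n. 3 ^ Suc k * a (n + Suc k)" r]
    by (auto simp: a_def power_divide power_add)
  have "t = (\<Sum>n. a (n + Suc k)) + (\<Sum>n<Suc k. a n)"
    unfolding t_def using suminf_split_initial_segment[OF summ[of 0, simplified], of "Suc k"]
    by (simp add: a_def)
  then have "3 ^ k * t = r / 3 + 3 ^ k * a k + (\<Sum>n<k. 3 ^ k * a n)"
    by (simp add: r_def algebra_simps sum_distrib_right)
  also have "3 ^ k * a k = 2 * of_bool (c k) / 3" by (simp add: a_def)
  also have "(\<Sum>n<k. 3 ^ k * a n) = (\<Sum>n<k. 2 * (of_bool (c n) * 3 ^ (k - Suc n)))"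
  proof (rule sum.cong[OF refl])
    fix n assume "n \<in> {..<k}"
    then have "(3::real) ^ k = 3 ^ Suc n * 3 ^ (k - Suc n)"
      by (simp add: power_add[symmetric] del: power_Suc)
    then show "3 ^ k * a n = 2 * (of_bool (c n) * 3 ^ (k - Suc n))"
      by (simp add: a_def)
  qed
  also have "\<dots> = of_int (2 * (\<Sum>n<k. of_bool (c n) * 3 ^ (k - Suc n)))"
    by (simp only: sum_distrib_left of_int_mult of_int_sum of_int_of_bool of_int_power of_int_numeral)
  finally have "3 ^ k * t = (r + 2 * of_bool (c k)) / 3 + of_int (2 * (\<Sum>n<k. of_bool (c n) * 3 ^ (k - Suc n)))"
    by (simp only: add_divide_distrib)
  then obtain m :: int where m: "3 ^ k * t = (r + 2 * of_bool (c k)) / 3 + of_int (2 * m)"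
    by blast
  have "cos (pi * (3 ^ k * t)) = cos (pi * ((r + 2 * of_bool (c k)) / 3) + 2 * pi * of_int m)"
    unfolding m by (simp add: algebra_simps)
  also have "\<dots> = cos (pi * ((r + 2 * of_bool (c k)) / 3))"
    by (simp only: cos_add cos_int_2pin sin_int_2pin mult_1_right mult_zero_right diff_zero)
  finally have e: "cos (pi * (3 ^ k * t)) = cos (pi * ((r + 2 * of_bool (c k)) / 3))" .
  show ?thesis
  proof (cases "c k")
    case True
    have "cos (pi * ((r + 2) / 3)) \<le> cos (2 * pi / 3)"
      using r0 r1 by (intro cos_monotone_0_pi_le) (auto simp: field_simps)
    then show ?thesis using True e by (simp add: fold_wave_def cos_120)
  next
    case False
    have "cos (pi / 3) \<le> cos (pi * (r / 3))"
      using r0 r1 by (intro cos_monotone_0_pi_le) (auto simp: field_simps)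
    then show ?thesis using False e by (simp add: fold_wave_def cos_60)
  qed
qed

lemma fold_wave_ternary_digits_in_unit:
  fixes c :: "nat \<Rightarrow> bool"
  shows "(\<Sum>n. 2 * of_bool (c n) / 3 ^ Suc n :: real) \<in> {0..1}"
proof -
  have geo: "(\<lambda>n. (2 / 3) * (1 / 3) ^ n :: real) sums ((2 / 3) * (1 / (1 - 1 / 3)))"
    by (intro sums_mult geometric_sums) auto
  have s: "summable (\<lambda>n. 2 * of_bool (c n) / 3 ^ Suc n :: real)"
    by (rule summable_comparison_test'[OF sums_summable[OF geo], of 0]) (auto simp: power_divide)
  have "(\<Sum>n. 2 * of_bool (c n) / 3 ^ Suc n :: real) \<le> 1"
    using sums_le[OF _ summable_sums[OF s] geo] by (auto simp: power_divide)
  then show ?thesis using suminf_nonneg[OF s] by auto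
qed

text \<open>The binary digits of the two coordinates are interleaved and doubled, which gives the
  ternary digits of the parameter.\<close>

lemma schoenberg_onto_unit_square:
  assumes "0 \<le> Re z" "Re z \<le> 1" "0 \<le> Im z" "Im z \<le> 1"
  shows "\<exists>t\<in>{0..1}. schoenberg t = z"
proof -
  from assms obtain a b where a: "(\<lambda>n. of_bool (a n) / 2 ^ Suc n) sums Re z"
    and b: "(\<lambda>n. of_bool (b n) / 2 ^ Suc n) sums Im z"
    using binary_expansion_exists by metis
  define c where "c n = (if even n then a (n div 2) else b (n div 2))" for n
  define t :: real where "t = (\<Sum>n. 2 * of_bool (c n) / 3 ^ Suc n)"
  have "fold_wave (3 ^ k * t) = of_bool (c k)" for k
    unfolding t_def by (rule fold_wave_ternary_digit)
  then have "fold_wave (3 ^ (2 * n) * t) = of_bool (a n)"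
    "fold_wave (3 ^ (2 * n + 1) * t) = of_bool (b n)" for n
    by (simp_all add: c_def del: power_Suc)
  then have "schoenberg t = z"
    using sums_unique[OF a] sums_unique[OF b]
    by (simp add: schoenberg_def complex_eq_iff del: power_Suc)
  then show ?thesis using fold_wave_ternary_digits_in_unit[of c] by (auto simp: t_def)
qed

section \<open>Green energy and greedy point sequences\<close>

definition pseudo_hyperbolic :: "complex \<Rightarrow> complex \<Rightarrow> real" where
  "pseudo_hyperbolic z w = cmod (z - w) / cmod (1 - cnj w * z)"

text \<open>For distinct points of the disc this is the minimum of the Green function and M, and on
  the diagonal it is M. Placing the maximum inside the logarithm makes the kernel continuous across
  the diagonal.\<close>

definition truncated_green :: "real \<Rightarrow> complex \<Rightarrow> complex \<Rightarrow> real" where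
  "truncated_green M z w = - ln (max (pseudo_hyperbolic z w) (exp (- M)))"

lemma pseudo_hyperbolic_nonneg: "0 \<le> pseudo_hyperbolic z w"
  by (simp add: pseudo_hyperbolic_def)

lemma pseudo_hyperbolic_commute: "pseudo_hyperbolic z w = pseudo_hyperbolic w z"
proof -
  have "1 - cnj w * z = cnj (1 - cnj z * w)" by (simp add: mult.commute)
  then have "cmod (1 - cnj w * z) = cmod (1 - cnj z * w)" by (simp only: complex_mod_cnj)
  then show ?thesis by (simp add: pseudo_hyperbolic_def norm_minus_commute)
qed

lemma one_minus_cnj_mult_nonzero:
  assumes "cmod z < 1" "cmod w < 1" shows "1 - cnj w * z \<noteq> 0"
proof
  assume "1 - cnj w * z = 0"
  then have "cmod w * cmod z = 1" by (metis complex_mod_cnj norm_mult norm_one eq_iff_diff_eq_0)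
  then show False using assms mult_strict_mono[of "cmod w" 1 "cmod z" 1] by auto
qed

lemma pseudo_hyperbolic_less_1:
  assumes z: "cmod z < 1" and w: "cmod w < 1" shows "pseudo_hyperbolic z w < 1"
proof -
  have "(cmod (1 - cnj w * z))\<^sup>2 - (cmod (z - w))\<^sup>2 = (1 - (cmod z)\<^sup>2) * (1 - (cmod w)\<^sup>2)"
    unfolding cmod_power2 by (simp add: algebra_simps power2_eq_square)
  moreover have "0 < (1 - (cmod z)\<^sup>2) * (1 - (cmod w)\<^sup>2)"
    using z w by (intro mult_pos_pos) (auto simp: abs_square_less_1)
  ultimately have "(cmod (z - w))\<^sup>2 < (cmod (1 - cnj w * z))\<^sup>2" by simp
  then have "cmod (z - w) < cmod (1 - cnj w * z)" by (rule power2_less_imp_less) simp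
  then show ?thesis
    using one_minus_cnj_mult_nonzero[OF z w] by (simp add: pseudo_hyperbolic_def)
qed

lemma tendsto_pseudo_hyperbolic:
  assumes "(f \<longlongrightarrow> z) F" "(g \<longlongrightarrow> w) F" "cmod z < 1" "cmod w < 1"
  shows "((\<lambda>x. pseudo_hyperbolic (f x) (g x)) \<longlongrightarrow> pseudo_hyperbolic z w) F"
  unfolding pseudo_hyperbolic_def
  using one_minus_cnj_mult_nonzero[OF assms(3,4)]
  by (intro tendsto_intros assms tendsto_cnj) auto

lemma tendsto_truncated_green:
  assumes "(f \<longlongrightarrow> z) F" "(g \<longlongrightarrow> w) F" "cmod z < 1" "cmod w < 1"
  shows "((\<lambda>x. truncated_green M (f x) (g x)) \<longlongrightarrow> truncated_green M z w) F"
  unfolding truncated_green_def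
  by (intro tendsto_intros tendsto_pseudo_hyperbolic assms)
     (use exp_gt_zero[of "-M"] in \<open>auto simp: max_def split: if_splits\<close>)

lemma borel_measurable_cnj [measurable (raw)]:
  "f \<in> borel_measurable N \<Longrightarrow> (\<lambda>x. cnj (f x)) \<in> borel_measurable N"
  by (rule measurable_compose[OF _ borel_measurable_continuous_onI]) (auto intro: continuous_intros)

lemma borel_measurable_truncated_green [measurable (raw)]:
  assumes [measurable]: "f \<in> borel_measurable N" "g \<in> borel_measurable N"
  shows "(\<lambda>x. truncated_green M (f x) (g x)) \<in> borel_measurable N"
  unfolding truncated_green_def pseudo_hyperbolic_def by measurable

lemma borel_measurable_green [measurable (raw)]:
  assumes [measurable]: "f \<in> borel_measurable N" "g \<in> borel_measurable N"
  shows "(\<lambda>x. green (f x) (g x)) \<in> borel_measurable N"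
  unfolding green_def by measurable

lemma truncated_green_nonneg:
  assumes "0 \<le> M" "cmod z < 1" "cmod w < 1" shows "0 \<le> truncated_green M z w"
proof -
  have "0 < max (pseudo_hyperbolic z w) (exp (- M))" by (rule less_le_trans[OF exp_gt_zero[of "-M"]]) simp
  then show ?thesis
    using pseudo_hyperbolic_less_1[OF assms(2,3)] assms(1) by (simp add: truncated_green_def)
qed

lemma truncated_green_le: "truncated_green M z w \<le> M"
proof -
  have "ln (exp (- M)) \<le> ln (max (pseudo_hyperbolic z w) (exp (- M)))"
    by (rule ln_mono) auto
  then show ?thesis by (simp add: truncated_green_def)
qed

lemma truncated_green_commute: "truncated_green M z w = truncated_green M w z"
  by (simp add: truncated_green_def pseudo_hyperbolic_commute)

lemma truncated_green_le_minus_ln: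
  "0 < pseudo_hyperbolic z w \<Longrightarrow> truncated_green M z w \<le> - ln (pseudo_hyperbolic z w)"
  by (simp add: truncated_green_def ln_mono)

lemma truncated_green_mono: "M \<le> M' \<Longrightarrow> truncated_green M z w \<le> truncated_green M' z w"
proof -
  assume "M \<le> M'"
  then have "max (pseudo_hyperbolic z w) (exp (- M')) \<le> max (pseudo_hyperbolic z w) (exp (- M))"
    by (intro max.mono) auto
  then show ?thesis
    unfolding truncated_green_def by (intro le_imp_neg_le ln_mono) (auto simp: max.strict_coboundedI2)
qed

text \<open>Off the diagonal the supremum is attained once n exceeds the Green function; on the
  diagonal the n-th truncation equals n. This lets monotone convergence remove the
  truncation.\<close>

lemma green_eq_SUP_truncated_green:
  assumes z: "cmod z < 1" and w: "cmod w < 1"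
  shows "green z w = (SUP n. ennreal (truncated_green (real n) z w))"
proof (cases "z = w")
  case True
  then have "truncated_green (real n) z w = real n" for n
    by (simp add: truncated_green_def pseudo_hyperbolic_def)
  then show ?thesis using True by (simp add: green_def ennreal_SUP_of_nat_eq_top flip: ennreal_of_nat_eq_real_of_nat)
next
  case False
  let ?r = "pseudo_hyperbolic z w"
  have r: "0 < ?r" using False one_minus_cnj_mult_nonzero[OF z w] by (simp add: pseudo_hyperbolic_def)
  have g: "green z w = ennreal (- ln ?r)"
    using False r by (simp add: green_def pseudo_hyperbolic_def norm_divide flip: ln_inverse)
  obtain n :: nat where n: "- ln ?r \<le> real n" using real_arch_simple by blast
  then have "exp (- real n) \<le> ?r" using r by (metis exp_ln exp_le_cancel_iff minus_le_iff)
  then have "truncated_green (real n) z w = - ln ?r" by (simp add: truncated_green_def max_def)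
  then show ?thesis unfolding g
    by (intro antisym SUP_least ennreal_leI truncated_green_le_minus_ln r)
       (metis UNIV_I SUP_upper)
qed

section \<open>Greedy sequences and the energy of their weak limits\<close>

text \<open>Adding point n increases the double sum by twice its interaction with the earlier
  points, at most 2 n c, and by one diagonal term, at most M. The induction closes because 2 n <= (n
  + 1)^2 - n^2.\<close>

lemma sum_truncated_green_le:
  assumes c: "0 \<le> c" and prod: "\<And>n. exp (- (real n * c)) \<le> (\<Prod>i<n. pseudo_hyperbolic (z n) (z i))"
  shows "(\<Sum>i<n. \<Sum>j<n. truncated_green M (z i) (z j)) \<le> real n * M + (real n)\<^sup>2 * c"
proof (induction n)
  case (Suc n)
  let ?F = "\<lambda>i j. truncated_green M (z i) (z j)"
  \<comment> \<open>The lower bound on the product excludes zero factors, so the points are distinct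
    and the logarithms are genuine.\<close>
  have pos: "0 < pseudo_hyperbolic (z n) (z i)" if "i < n" for i
  proof -
    have "(\<Prod>i<n. pseudo_hyperbolic (z n) (z i)) \<noteq> 0"
      using less_le_trans[OF exp_gt_zero prod[of n]] by linarith
    then have "pseudo_hyperbolic (z n) (z i) \<noteq> 0" using that by auto
    then show ?thesis using pseudo_hyperbolic_nonneg[of "z n" "z i"] by simp
  qed
  have "(\<Sum>i<n. ?F n i) \<le> (\<Sum>i<n. - ln (pseudo_hyperbolic (z n) (z i)))"
    by (intro sum_mono truncated_green_le_minus_ln pos) auto
  also have "\<dots> = - ln (\<Prod>i<n. pseudo_hyperbolic (z n) (z i))"
    by (subst ln_prod) (auto simp: sum_negf dest!: pos)
  also have "\<dots> \<le> real n * c"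
    using ln_mono[OF prod[of n]] by simp
  finally have S: "(\<Sum>i<n. ?F n i) \<le> real n * c" .
  have "(\<Sum>i<Suc n. \<Sum>j<Suc n. ?F i j) = (\<Sum>i<n. \<Sum>j<n. ?F i j) + 2 * (\<Sum>i<n. ?F n i) + ?F n n"
  proof -
    have "(\<Sum>i<n. ?F i n) = (\<Sum>i<n. ?F n i)"
      by (intro sum.cong refl truncated_green_commute)
    then show ?thesis by (simp add: sum.distrib)
  qed
  also have "\<dots> \<le> (real n * M + (real n)\<^sup>2 * c) + 2 * (real n * c) + M"
    using Suc.IH S truncated_green_le[of M "z n" "z n"] by linarith
  also have "\<dots> \<le> real (Suc n) * M + (real (Suc n))\<^sup>2 * c"
    using c by (simp add: power2_eq_square algebra_simps)
  finally show ?case .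
qed simp

text \<open>The hypothesis is applied to the points already chosen; its case m = 0 supplies the
  first point.\<close>

lemma exists_greedy_sequence:
  assumes "\<And>m p. (\<And>i. i < m \<Longrightarrow> p i \<in> K) \<Longrightarrow>
      \<exists>z\<in>K. exp (- (real m * c)) \<le> (\<Prod>i<m. pseudo_hyperbolic z (p i))"
  shows "\<exists>z. \<forall>n. z n \<in> K \<and> exp (- (real n * c)) \<le> (\<Prod>i<n. pseudo_hyperbolic (z n) (z i))"
proof (rule dependent_wellorder_choice)
  fix r and f g :: "nat \<Rightarrow> complex" and n :: nat
  assume "\<And>y. y < n \<Longrightarrow> f y = g y"
  then show "(r \<in> K \<and> exp (- (real n * c)) \<le> (\<Prod>i<n. pseudo_hyperbolic r (f i))) =
      (r \<in> K \<and> exp (- (real n * c)) \<le> (\<Prod>i<n. pseudo_hyperbolic r (g i)))"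
    by simp
next
  fix n f assume "\<And>y. y < n \<Longrightarrow> f y \<in> K \<and> exp (- (real y * c)) \<le> (\<Prod>i<y. pseudo_hyperbolic (f y) (f i))"
  then show "\<exists>r. r \<in> K \<and> exp (- (real n * c)) \<le> (\<Prod>i<n. pseudo_hyperbolic r (f i))"
    using assms[of n f] by blast
qed

text \<open>Weak compactness in the plane is obtained from Helly's theorem on the real line by lifting
  the points along a space-filling curve; Skorohod's coupling then replaces weak convergence by
  pointwise convergence.\<close>

lemma empirical_measures_coupling:
  fixes z :: "nat \<Rightarrow> complex"
  assumes K: "closed K" "K \<subseteq> ball 0 1" and z: "\<And>n. z n \<in> K"
  shows "\<exists>(\<Omega>::real measure) Zs Z r. prob_space \<Omega> \<and> (\<forall>n. Zs n \<in> borel_measurable \<Omega>) \<and> Z \<in> borel_measurable \<Omega> \<and>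
     strict_mono (r::nat \<Rightarrow> nat) \<and> (\<forall>x\<in>space \<Omega>. (\<lambda>n. Zs n x) \<longlonglongrightarrow> Z x) \<and>
     (\<forall>n f. f \<in> borel_measurable borel \<longrightarrow>
        (\<integral>\<^sup>+ x. f (Zs n x) \<partial>\<Omega>) = (\<Sum>i\<le>r n. f (z i)) / of_nat (Suc (r n))) \<and>
     (AE x in \<Omega>. Z x \<in> K \<and> (\<forall>n. Zs n x \<in> K))"
proof -
  \<comment> \<open>The curve is rescaled to fill [-1, 1]^2, which contains the disc, so every
    \<open>z n\<close> has a preimage in [0, 1].\<close>
  define h where "h t = 2 * schoenberg t - Complex 1 1" for t
  have hc: "continuous_on UNIV h"
    unfolding h_def by (intro continuous_intros continuous_on_schoenberg)
  have hm [measurable]: "h \<in> borel_measurable borel"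
    by (rule borel_measurable_continuous_onI[OF hc])
  have "\<exists>t\<in>{0..1}. h t = z n" for n
  proof -
    have "cmod (z n) < 1" using z K by (auto simp: subset_iff)
    then have "\<bar>Re (z n)\<bar> < 1" "\<bar>Im (z n)\<bar> < 1"
      using abs_Re_le_cmod[of "z n"] abs_Im_le_cmod[of "z n"] by linarith+
    then have "\<exists>t\<in>{0..1}. schoenberg t = (z n + Complex 1 1) / 2"
      by (intro schoenberg_onto_unit_square) auto
    then obtain u where "u \<in> {0..1}" "schoenberg u = (z n + Complex 1 1) / 2" by blast
    moreover from this have "2 * schoenberg u = z n + Complex 1 1" by (simp add: mult.commute)
    ultimately show ?thesis unfolding h_def by (intro bexI[of _ u]) (auto simp only: add_diff_cancel_right')
  qed
  then obtain t where t: "\<And>n. t n \<in> {0..1}" "\<And>n. h (t n) = z n" by metis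
  \<comment> \<open>The uniform measure on the lifts of z 0, ..., z n. These are n + 1 terms, whence
    \<open>Suc (r n)\<close> in the averages.\<close>
  define \<nu> where "\<nu> n = distr (measure_pmf (pmf_of_set {..n})) borel t" for n :: nat
  have rd: "real_distribution (\<nu> n)" for n
    unfolding \<nu>_def by (intro prob_space.real_distribution_distr) (auto simp: measure_pmf.prob_space_axioms)
  have "tight \<nu>"
    unfolding tight_def
  proof (intro conjI allI impI rd)
    fix e :: real assume e: "0 < e"
    \<comment> \<open>Tightness is phrased with half-open intervals; the left end -1 keeps the
      parameter 0 inside.\<close>
    have "measure (\<nu> n) {-1<..1} = 1" for n
    proof -
      interpret real_distribution "\<nu> n" by (rule rd)
      have "AE x in \<nu> n. x \<in> {-1<..1}"
        unfolding \<nu>_def using t(1) by (subst AE_distr_iff) (auto simp: less_le_trans[of "-1" 0])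
      then show ?thesis by (subst prob_eq_1) auto
    qed
    then show "\<exists>a b. a < b \<and> (\<forall>n. 1 - e < measure (\<nu> n) {a<..b})"
      using e by (intro exI[of _ "-1"] exI[of _ 1]) auto
  qed
  then obtain r N where r: "strict_mono r" "real_distribution N" "weak_conv_m (\<nu> \<circ> id \<circ> r) N"
    using tight_imp_convergent_subsubsequence[of \<nu> id] by (auto simp: strict_mono_id)
  have "\<exists> (\<Omega> :: real measure) (Y_seq :: nat \<Rightarrow> real \<Rightarrow> real) (Y :: real \<Rightarrow> real).
    prob_space \<Omega> \<and> (\<forall>n. Y_seq n \<in> measurable \<Omega> borel) \<and>
    (\<forall>n. distr \<Omega> borel (Y_seq n) = (\<nu> \<circ> id \<circ> r) n) \<and> Y \<in> measurable \<Omega> lborel \<and>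
    distr \<Omega> borel Y = N \<and> (\<forall>x \<in> space \<Omega>. (\<lambda>n. Y_seq n x) \<longlonglongrightarrow> Y x)"
    by (rule Skorohod[OF _ r(2,3)]) (simp add: rd)
  then obtain \<Omega> :: "real measure" and Ys Y where \<Omega>: "prob_space \<Omega>"
    and Ys [measurable]: "\<And>n. Ys n \<in> borel_measurable \<Omega>"
    and dY: "\<And>n. distr \<Omega> borel (Ys n) = \<nu> (r n)"
    and Y [measurable]: "Y \<in> borel_measurable \<Omega>"
    and lim: "\<And>x. x \<in> space \<Omega> \<Longrightarrow> (\<lambda>n. Ys n x) \<longlonglongrightarrow> Y x"
    unfolding o_def id_def measurable_cong_sets[OF refl sets_lborel] by blast
  have limh: "(\<lambda>n. h (Ys n x)) \<longlonglongrightarrow> h (Y x)" if "x \<in> space \<Omega>" for x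
    using hc lim[OF that] by (auto intro: isCont_tendsto_compose simp: continuous_on_eq_continuous_at)
  have "AE x in \<Omega>. h (Ys n x) \<in> K" for n
  proof -
    have [measurable]: "K \<in> sets borel" using K by auto
    have "AE x in \<nu> (r n). h x \<in> K"
      unfolding \<nu>_def using t(2) z by (subst AE_distr_iff) auto
    then show ?thesis
      unfolding dY[symmetric] by (subst (asm) AE_distr_iff) auto
  qed
  then have "AE x in \<Omega>. \<forall>n. h (Ys n x) \<in> K" by (simp add: AE_all_countable)
  with AE_space have AE: "AE x in \<Omega>. h (Y x) \<in> K \<and> (\<forall>n. h (Ys n x) \<in> K)"
  proof eventually_elim
    case (elim x)
    then show ?case using closed_sequentially[OF K(1), of "\<lambda>n. h (Ys n x)"] limh by blast
  qed
  have int: "(\<integral>\<^sup>+ x. f (h (Ys n x)) \<partial>\<Omega>) = (\<Sum>i\<le>r n. f (z i)) / of_nat (Suc (r n))"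
    if [measurable]: "f \<in> borel_measurable borel" for f n
  proof -
    have "(\<integral>\<^sup>+ x. f (h (Ys n x)) \<partial>\<Omega>) = (\<integral>\<^sup>+ y. f (h y) \<partial>\<nu> (r n))"
      unfolding dY[symmetric] by (subst nn_integral_distr) auto
    also have "\<dots> = (\<integral>\<^sup>+ i. f (z i) \<partial>measure_pmf (pmf_of_set {..r n}))"
      unfolding \<nu>_def by (subst nn_integral_distr) (auto simp: t)
    finally show ?thesis by (subst (asm) nn_integral_pmf_of_set) auto
  qed
  show ?thesis
    by (rule exI[of _ \<Omega>], rule exI[of _ "\<lambda>n x. h (Ys n x)"], rule exI[of _ "\<lambda>x. h (Y x)"],
        rule exI[of _ r], intro conjI allI ballI impI \<Omega> r(1) limh AE int) measurable
qed

text \<open>The law of the limit \<open>Z\<close> is a competitor in the infimum. Its energy is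
  reached in two limits: at a fixed truncation, Fatou's lemma, once for each variable, lets the
  number of points grow; monotone convergence then lets the truncation grow.\<close>

lemma green_V_le:
  assumes K: "compact K" "K \<subseteq> ball 0 1" and c: "0 \<le> c"
    and prod: "\<And>m p. (\<And>i. i < m \<Longrightarrow> p i \<in> K) \<Longrightarrow>
      \<exists>z\<in>K. exp (- (real m * c)) \<le> (\<Prod>i<m. pseudo_hyperbolic z (p i))"
  shows "green_V K \<le> ennreal c"
proof -
  obtain z where zK: "\<And>n. z n \<in> K"
    and z: "\<And>n. exp (- (real n * c)) \<le> (\<Prod>i<n. pseudo_hyperbolic (z n) (z i))"
    using exists_greedy_sequence[of K c] prod by blast
  have K1: "cmod w < 1" if "w \<in> K" for w using K that by (auto simp: subset_iff)
  have z1: "cmod (z n) < 1" for n by (rule K1[OF zK])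
  obtain \<Omega> :: "real measure" and Zs Z and r :: "nat \<Rightarrow> nat"
    where \<Omega>: "prob_space \<Omega>" and [measurable]: "\<And>n. Zs n \<in> borel_measurable \<Omega>" "Z \<in> borel_measurable \<Omega>"
      and r: "strict_mono r" and lim: "\<And>x. x \<in> space \<Omega> \<Longrightarrow> (\<lambda>n. Zs n x) \<longlonglongrightarrow> Z x"
      and int: "\<And>n f. f \<in> borel_measurable borel \<Longrightarrow>
        (\<integral>\<^sup>+ x. f (Zs n x) \<partial>\<Omega>) = (\<Sum>i\<le>r n. f (z i)) / of_nat (Suc (r n))"
      and AE: "AE x in \<Omega>. Z x \<in> K \<and> (\<forall>n. Zs n x \<in> K)"
    using empirical_measures_coupling[of K z, OF compact_imp_closed[OF K(1)] K(2) zK] by blast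
  interpret \<Omega>: prob_space \<Omega> by fact
  let ?F = "\<lambda>m v w. ennreal (truncated_green (real m) v w)"
  \<comment> \<open>As a and b are integrated independently, this is the truncated energy of the
    empirical measure: the double sum divided by the square of \<open>Suc (r n)\<close>.\<close>
  have bound: "(\<integral>\<^sup>+ a. (\<integral>\<^sup>+ b. ?F m (Zs n a) (Zs n b) \<partial>\<Omega>) \<partial>\<Omega>) \<le> ennreal (real m / real (Suc (r n)) + c)" for m n
  proof -
    let ?N = "Suc (r n)"
    have "(\<integral>\<^sup>+ a. (\<integral>\<^sup>+ b. ?F m (Zs n a) (Zs n b) \<partial>\<Omega>) \<partial>\<Omega>)
        = (\<integral>\<^sup>+ a. (\<Sum>j\<le>r n. ?F m (Zs n a) (z j)) / of_nat ?N \<partial>\<Omega>)"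
      by (intro nn_integral_cong int) measurable
    also have "\<dots> = (\<Sum>i\<le>r n. (\<Sum>j\<le>r n. ?F m (z i) (z j)) / of_nat ?N) / of_nat ?N"
      by (rule int) measurable
    also have "\<dots> = ennreal ((\<Sum>i\<le>r n. (\<Sum>j\<le>r n. truncated_green (real m) (z i) (z j)) / real ?N) / real ?N)"
      using z1 by (simp add: truncated_green_nonneg sum_nonneg divide_ennreal ennreal_of_nat_eq_real_of_nat del: of_nat_Suc)
    also have "(\<Sum>i\<le>r n. (\<Sum>j\<le>r n. truncated_green (real m) (z i) (z j)) / real ?N) / real ?N
        = (\<Sum>i<?N. \<Sum>j<?N. truncated_green (real m) (z i) (z j)) / (real ?N)\<^sup>2"
      by (simp add: sum_divide_distrib[symmetric] lessThan_Suc_atMost power2_eq_square)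
    also have "\<dots> \<le> (real ?N * real m + (real ?N)\<^sup>2 * c) / (real ?N)\<^sup>2"
      by (intro divide_right_mono sum_truncated_green_le c z) auto
    also have "\<dots> = real m / real ?N + c"
      by (simp add: add_divide_distrib power2_eq_square del: of_nat_Suc)
    finally show ?thesis by (simp add: ennreal_leI)
  qed
  have trunc: "(\<integral>\<^sup>+ a. (\<integral>\<^sup>+ b. ?F m (Z a) (Z b) \<partial>\<Omega>) \<partial>\<Omega>) \<le> ennreal c" for m
  proof -
    have conv: "?F m (Z a) (Z b) = liminf (\<lambda>n. ?F m (Zs n a) (Zs n b))"
      if "a \<in> space \<Omega>" "b \<in> space \<Omega>" "Z a \<in> K" "Z b \<in> K" for a b
      using that by (intro lim_imp_Liminf[symmetric] tendsto_ennrealI tendsto_truncated_green lim K1) auto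
    have "(\<integral>\<^sup>+ a. (\<integral>\<^sup>+ b. ?F m (Z a) (Z b) \<partial>\<Omega>) \<partial>\<Omega>)
        \<le> (\<integral>\<^sup>+ a. liminf (\<lambda>n. \<integral>\<^sup>+ b. ?F m (Zs n a) (Zs n b) \<partial>\<Omega>) \<partial>\<Omega>)"
    proof (rule nn_integral_mono_AE, use AE AE_space in eventually_elim)
      case (elim a)
      have "(\<integral>\<^sup>+ b. ?F m (Z a) (Z b) \<partial>\<Omega>) = (\<integral>\<^sup>+ b. liminf (\<lambda>n. ?F m (Zs n a) (Zs n b)) \<partial>\<Omega>)"
        by (rule nn_integral_cong_AE, use AE AE_space in eventually_elim) (use elim conv in auto)
      also have "\<dots> \<le> liminf (\<lambda>n. \<integral>\<^sup>+ b. ?F m (Zs n a) (Zs n b) \<partial>\<Omega>)"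
        by (rule nn_integral_liminf) measurable
      finally show ?case .
    qed
    also have "\<dots> \<le> liminf (\<lambda>n. \<integral>\<^sup>+ a. (\<integral>\<^sup>+ b. ?F m (Zs n a) (Zs n b) \<partial>\<Omega>) \<partial>\<Omega>)"
      by (rule nn_integral_liminf) measurable
    also have "\<dots> \<le> liminf (\<lambda>n. ennreal (real m / real (Suc (r n)) + c))"
      by (intro Liminf_mono always_eventually allI bound)
    also have "\<dots> = ennreal c"
    proof (rule lim_imp_Liminf)
      have "(\<lambda>n. real m / real (Suc n)) \<longlonglongrightarrow> 0"
        using LIMSEQ_Suc[OF lim_const_over_n[of "real m"]] by simp
      then have "(\<lambda>n. real m / real (Suc (r n))) \<longlonglongrightarrow> 0"
        using LIMSEQ_subseq_LIMSEQ[OF _ r] by (auto simp: o_def)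
      from tendsto_add[OF this tendsto_const[of c]]
      show "(\<lambda>n. ennreal (real m / real (Suc (r n)) + c)) \<longlonglongrightarrow> ennreal c"
        by (intro tendsto_ennrealI) simp
    qed simp
    finally show ?thesis .
  qed
  define \<mu> where "\<mu> = distr \<Omega> borel Z"
  have "green_energy \<mu> = (\<integral>\<^sup>+ a. (\<integral>\<^sup>+ b. green (Z a) (Z b) \<partial>\<Omega>) \<partial>\<Omega>)"
  proof -
    interpret \<mu>: prob_space \<mu> unfolding \<mu>_def by (rule \<Omega>.prob_space_distr) measurable
    have [measurable_cong]: "sets \<mu> = sets borel" by (simp add: \<mu>_def)
    have "(\<integral>\<^sup>+ w. green v w \<partial>\<mu>) = (\<integral>\<^sup>+ b. green v (Z b) \<partial>\<Omega>)" for v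
      unfolding \<mu>_def by (rule nn_integral_distr) measurable
    moreover have "(\<integral>\<^sup>+ v. (\<integral>\<^sup>+ b. green v (Z b) \<partial>\<Omega>) \<partial>\<mu>) = (\<integral>\<^sup>+ a. (\<integral>\<^sup>+ b. green (Z a) (Z b) \<partial>\<Omega>) \<partial>\<Omega>)"
      unfolding \<mu>_def by (rule nn_integral_distr) measurable
    ultimately show ?thesis by (simp add: green_energy_def)
  qed
  also have "\<dots> = (\<integral>\<^sup>+ a. (SUP m. \<integral>\<^sup>+ b. ?F m (Z a) (Z b) \<partial>\<Omega>) \<partial>\<Omega>)"
  proof (rule nn_integral_cong_AE, use AE in eventually_elim)
    case (elim a)
    have "(\<integral>\<^sup>+ b. green (Z a) (Z b) \<partial>\<Omega>) = (\<integral>\<^sup>+ b. (SUP m. ?F m (Z a) (Z b)) \<partial>\<Omega>)"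
      by (rule nn_integral_cong_AE, use AE in eventually_elim)
         (use elim K1 green_eq_SUP_truncated_green in auto)
    also have "\<dots> = (SUP m. \<integral>\<^sup>+ b. ?F m (Z a) (Z b) \<partial>\<Omega>)"
      by (rule nn_integral_monotone_convergence_SUP)
         (auto simp: incseq_def le_fun_def intro!: ennreal_leI truncated_green_mono)
    finally show ?case .
  qed
  also have "\<dots> = (SUP m. \<integral>\<^sup>+ a. (\<integral>\<^sup>+ b. ?F m (Z a) (Z b) \<partial>\<Omega>) \<partial>\<Omega>)"
    by (rule nn_integral_monotone_convergence_SUP)
       (auto simp: incseq_def le_fun_def intro!: nn_integral_mono ennreal_leI truncated_green_mono)
  also have "\<dots> \<le> ennreal c" by (intro SUP_least trunc)
  finally have "green_energy \<mu> \<le> ennreal c" .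
  moreover have "prob_space \<mu>" unfolding \<mu>_def by (rule \<Omega>.prob_space_distr) measurable
  moreover have "emeasure \<mu> (UNIV - K) = 0"
  proof -
    have [measurable]: "K \<in> sets borel" using K(1) by (intro borel_closed compact_imp_closed)
    have "AE x in \<mu>. x \<in> K"
      unfolding \<mu>_def using AE by (subst AE_distr_iff) (auto elim: eventually_mono)
    then have "AE x in \<mu>. \<not> x \<notin> K" by simp
    from emeasure_eq_0_AE[OF this] show ?thesis
      by (simp add: \<mu>_def Compl_eq_Diff_UNIV[symmetric] Collect_neg_eq)
  qed
  ultimately show ?thesis
    unfolding green_V_def using K by (intro INF_lower2[of \<mu>]) (auto simp: \<mu>_def)
qed

section \<open>The weighted space\<close>

lemma admissible_weight_pos:
  assumes "admissible_weight \<omega>" "cmod z < 1" shows "0 < \<omega> (cmod z)"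
proof -
  have "cmod z \<in> {0..<1}" using assms by simp
  then show ?thesis using assms unfolding admissible_weight_def by blast
qed

lemma borel_measurable_dir_integrand:
  assumes w: "admissible_weight \<omega>" and f: "f holomorphic_on ball 0 1"
  shows "(\<lambda>z. indicator (ball 0 1) z * ennreal ((cmod (deriv f z))\<^sup>2 * \<omega> (cmod z) / pi)) \<in> borel_measurable borel"
proof -
  have "continuous_on (ball 0 1) (\<lambda>z::complex. \<omega> (cmod z))"
  proof (rule continuous_on_compose2[where g=\<omega> and f=cmod])
    show "continuous_on {0..<1} \<omega>" using w by (simp add: admissible_weight_def)
    show "continuous_on (ball 0 1) cmod" by (rule continuous_on_norm_id)
  qed auto
  moreover have "continuous_on (ball 0 1) (deriv f)"
    by (intro holomorphic_on_imp_continuous_on holomorphic_deriv f) simp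
  ultimately have "continuous_on (ball 0 1) (\<lambda>z. (cmod (deriv f z))\<^sup>2 * \<omega> (cmod z) / pi)"
    by (auto intro!: continuous_intros)
  then have "(\<lambda>z. indicator (ball 0 1) z *\<^sub>R ((cmod (deriv f z))\<^sup>2 * \<omega> (cmod z) / pi)) \<in> borel_measurable borel"
    by (intro borel_measurable_continuous_on_indicator) auto
  then have "(\<lambda>z. ennreal (indicator (ball 0 1) z *\<^sub>R ((cmod (deriv f z))\<^sup>2 * \<omega> (cmod z) / pi))) \<in> borel_measurable borel"
    by measurable
  moreover have "ennreal (indicator (ball 0 1) z *\<^sub>R x) = indicator (ball 0 1) z * ennreal x" for z :: complex and x
    by (simp add: indicator_def)
  ultimately show ?thesis by (simp only:)
qed

lemma dir_integral_le_mult: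
  assumes w: "admissible_weight \<omega>" and g: "g holomorphic_on ball 0 1"
    and le: "\<And>z. cmod z < 1 \<Longrightarrow> cmod (deriv f z) \<le> A * cmod (deriv g z)"
  shows "dir_integral \<omega> f \<le> ennreal (A\<^sup>2) * dir_integral \<omega> g"
proof -
  have "dir_integral \<omega> f \<le> (\<integral>\<^sup>+ z. ennreal (A\<^sup>2) * (indicator (ball 0 1) z *
       ennreal ((cmod (deriv g z))\<^sup>2 * \<omega> (cmod z) / pi)) \<partial>lborel)"
    unfolding dir_integral_def
  proof (rule nn_integral_mono)
    fix z :: complex
    show "indicator (ball 0 1) z * ennreal ((cmod (deriv f z))\<^sup>2 * \<omega> (cmod z) / pi)
      \<le> ennreal (A\<^sup>2) * (indicator (ball 0 1) z * ennreal ((cmod (deriv g z))\<^sup>2 * \<omega> (cmod z) / pi))"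
    proof (cases "cmod z < 1")
      case True
      have "(cmod (deriv f z))\<^sup>2 \<le> A\<^sup>2 * (cmod (deriv g z))\<^sup>2"
        using power_mono[OF le[OF True], of 2] by (simp add: power_mult_distrib)
      then have "(cmod (deriv f z))\<^sup>2 * \<omega> (cmod z) / pi \<le> A\<^sup>2 * (cmod (deriv g z))\<^sup>2 * \<omega> (cmod z) / pi"
        using admissible_weight_pos[OF w True] by (intro divide_right_mono mult_right_mono) auto
      then show ?thesis using True by (simp add: ennreal_mult'[symmetric] ennreal_leI mult.assoc)
    qed simp
  qed
  also have "\<dots> = ennreal (A\<^sup>2) * dir_integral \<omega> g"
    unfolding dir_integral_def
    using borel_measurable_dir_integrand[OF w g] by (intro nn_integral_cmult) simp
  finally show ?thesis .
qed

lemma deriv_diff_on_disc: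
  assumes "f holomorphic_on ball 0 1" "g holomorphic_on ball 0 1" "cmod z < 1"
  shows "deriv (\<lambda>z. f z - g z) z = deriv f z - deriv g z"
  using assms by (intro deriv_diff holomorphic_on_imp_differentiable_at[of _ "ball 0 1"]) auto

lemma dir_integral_diff_le:
  assumes w: "admissible_weight \<omega>" and f: "f holomorphic_on ball 0 1" and g: "g holomorphic_on ball 0 1"
  shows "dir_integral \<omega> (\<lambda>z. f z - g z) \<le> 2 * dir_integral \<omega> f + 2 * dir_integral \<omega> g"
proof -
  let ?I = "\<lambda>f z. indicator (ball 0 1) z * ennreal ((cmod (deriv f z))\<^sup>2 * \<omega> (cmod z) / pi)"
  have [measurable]: "?I f \<in> borel_measurable lborel" "?I g \<in> borel_measurable lborel"
    using borel_measurable_dir_integrand[OF w] f g by simp_all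
  have "dir_integral \<omega> (\<lambda>z. f z - g z) \<le> (\<integral>\<^sup>+ z. 2 * ?I f z + 2 * ?I g z \<partial>lborel)"
    unfolding dir_integral_def
  proof (rule nn_integral_mono)
    fix z :: complex
    show "?I (\<lambda>z. f z - g z) z \<le> 2 * ?I f z + 2 * ?I g z"
    proof (cases "cmod z < 1")
      case True
      let ?a = "cmod (deriv f z)" and ?b = "cmod (deriv g z)"
      have "(cmod (deriv (\<lambda>z. f z - g z) z))\<^sup>2 \<le> (?a + ?b)\<^sup>2"
        using deriv_diff_on_disc[OF f g True] by (intro power_mono) (auto intro: norm_triangle_ineq4)
      also have "\<dots> \<le> 2 * ?a\<^sup>2 + 2 * ?b\<^sup>2"
        using sum_squares_bound[of ?a ?b] by (simp add: power2_sum)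
      finally have "(cmod (deriv (\<lambda>z. f z - g z) z))\<^sup>2 * (\<omega> (cmod z) / pi) \<le> (2 * ?a\<^sup>2 + 2 * ?b\<^sup>2) * (\<omega> (cmod z) / pi)"
        using admissible_weight_pos[OF w True] by (intro mult_right_mono) auto
      also have "\<dots> = 2 * (?a\<^sup>2 * \<omega> (cmod z) / pi) + 2 * (?b\<^sup>2 * \<omega> (cmod z) / pi)"
        by (simp add: algebra_simps add_divide_distrib)
      finally have "ennreal ((cmod (deriv (\<lambda>z. f z - g z) z))\<^sup>2 * \<omega> (cmod z) / pi)
        \<le> ennreal (2 * (?a\<^sup>2 * \<omega> (cmod z) / pi) + 2 * (?b\<^sup>2 * \<omega> (cmod z) / pi))"
        by (intro ennreal_leI) simp
      also have "\<dots> = 2 * ennreal (?a\<^sup>2 * \<omega> (cmod z) / pi) + 2 * ennreal (?b\<^sup>2 * \<omega> (cmod z) / pi)"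
        using admissible_weight_pos[OF w True]
        by (subst ennreal_plus) (auto simp: ennreal_mult' simp del: times_divide_eq_right)
      finally show ?thesis using True by simp
    qed simp
  qed
  also have "\<dots> = 2 * dir_integral \<omega> f + 2 * dir_integral \<omega> g"
    unfolding dir_integral_def by (simp add: nn_integral_add nn_integral_cmult)
  finally show ?thesis .
qed

lemma H_norm_nonneg: "0 \<le> H_norm \<omega> f"
  by (simp add: H_norm_def)

lemma H_norm_power2: "(H_norm \<omega> f)\<^sup>2 = (cmod (f 0))\<^sup>2 + enn2real (dir_integral \<omega> f)"
  by (simp add: H_norm_def)

lemma H_space_diff:
  assumes w: "admissible_weight \<omega>" and f: "f \<in> H_space \<omega>" and g: "g \<in> H_space \<omega>"
  shows "(\<lambda>z. f z - g z) \<in> H_space \<omega>"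
proof -
  have "2 * dir_integral \<omega> f + 2 * dir_integral \<omega> g < \<infinity>"
    using f g by (simp add: H_space_def ennreal_mult_less_top)
  moreover have fg: "f holomorphic_on ball 0 1" "g holomorphic_on ball 0 1"
    using f g by (auto simp: H_space_def)
  ultimately have "dir_integral \<omega> (\<lambda>z. f z - g z) < \<infinity>"
    using le_less_trans[OF dir_integral_diff_le[OF w fg]] by simp
  then show ?thesis
    using holomorphic_on_diff[OF fg] by (simp add: H_space_def)
qed

text \<open>A crude triangle inequality from (a + b)^2 <= 2 a^2 + 2 b^2. It is applied only to see
  that operators are bounded, so its constant does not enter the decay estimate.\<close>

lemma H_norm_diff_le:
  assumes w: "admissible_weight \<omega>" and f: "f \<in> H_space \<omega>" and g: "g \<in> H_space \<omega>"
  shows "H_norm \<omega> (\<lambda>z. f z - g z) \<le> 2 * (H_norm \<omega> f + H_norm \<omega> g)"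
proof -
  have fin: "dir_integral \<omega> f < \<infinity>" "dir_integral \<omega> g < \<infinity>" using f g by (auto simp: H_space_def)
  have "enn2real (dir_integral \<omega> (\<lambda>z. f z - g z)) \<le> enn2real (2 * dir_integral \<omega> f + 2 * dir_integral \<omega> g)"
    using fin f g by (intro enn2real_mono dir_integral_diff_le w) (auto simp: H_space_def ennreal_mult_less_top)
  also have "\<dots> = 2 * enn2real (dir_integral \<omega> f) + 2 * enn2real (dir_integral \<omega> g)"
    using fin by (simp add: enn2real_plus ennreal_mult_less_top enn2real_mult)
  finally have D: "enn2real (dir_integral \<omega> (\<lambda>z. f z - g z)) \<le> \<dots>" .
  have "(cmod (f 0 - g 0))\<^sup>2 \<le> (cmod (f 0) + cmod (g 0))\<^sup>2"
    by (intro power_mono norm_triangle_ineq4) auto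
  also have "\<dots> \<le> 2 * (cmod (f 0))\<^sup>2 + 2 * (cmod (g 0))\<^sup>2"
    using sum_squares_bound[of "cmod (f 0)" "cmod (g 0)"] by (simp add: power2_sum)
  finally have "(H_norm \<omega> (\<lambda>z. f z - g z))\<^sup>2 \<le> 2 * (H_norm \<omega> f)\<^sup>2 + 2 * (H_norm \<omega> g)\<^sup>2"
    using D by (simp add: H_norm_power2)
  also have "\<dots> \<le> (2 * (H_norm \<omega> f + H_norm \<omega> g))\<^sup>2"
  proof -
    have "0 \<le> H_norm \<omega> f * H_norm \<omega> g" by (simp add: H_norm_nonneg)
    then show ?thesis by (simp add: power2_sum power_mult_distrib)
  qed
  finally show ?thesis by (rule power2_le_imp_le) (simp add: H_norm_nonneg)
qed

lemma zero_in_H_space: "(\<lambda>z. 0) \<in> H_space \<omega>" and H_norm_zero: "H_norm \<omega> (\<lambda>z. 0) = 0"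
  by (simp_all add: H_space_def H_norm_def dir_integral_def)

text \<open>Integrability of the weight enters here. Composition with \<phi> sends the identity to
  \<phi>, which is thereby in the space.\<close>

lemma ident_in_H_space:
  assumes w: "admissible_weight \<omega>"
  shows "(\<lambda>z. z) \<in> H_space \<omega>"
proof -
  have cont: "continuous_on {0..<1} \<omega>" and pos: "\<And>r. r \<in> {0..<1} \<Longrightarrow> 0 < \<omega> r"
    and int: "set_integrable lborel {0..<1} \<omega>"
    using w unfolding admissible_weight_def by blast+
  define W where "W r = ennreal (indicator {0..<1} r *\<^sub>R \<omega> r)" for r
  have "(\<lambda>r. indicator {0..<1} r *\<^sub>R \<omega> r) \<in> borel_measurable borel"
    by (intro borel_measurable_continuous_on_indicator cont) auto
  then have Wm [measurable]: "W \<in> borel_measurable borel" unfolding W_def by measurable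
  have Wfin: "(\<integral>\<^sup>+ r. W r \<partial>lborel) < \<infinity>"
  proof -
    have "(\<integral>\<^sup>+ r. W r \<partial>lborel) = (\<integral>\<^sup>+ r. ennreal (norm (indicator {0..<1} r *\<^sub>R \<omega> r)) \<partial>lborel)"
      unfolding W_def by (intro nn_integral_cong) (auto simp: indicator_def less_imp_le[OF pos])
    also have "\<dots> < \<infinity>" using int by (simp add: set_integrable_def integrable_iff_bounded)
    finally show ?thesis .
  qed
  have "dir_integral \<omega> (\<lambda>z. z) \<le> (\<integral>\<^sup>+ z. W (cmod z) * indicator (ball 0 1) z \<partial>lborel)"
    unfolding dir_integral_def
  proof (rule nn_integral_mono)
    fix z :: complex
    show "indicator (ball 0 1) z * ennreal ((cmod (deriv (\<lambda>z. z) z))\<^sup>2 * \<omega> (cmod z) / pi)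
        \<le> W (cmod z) * indicator (ball 0 1) z"
    proof (cases "cmod z < 1")
      case True
      have "\<omega> (cmod z) / pi \<le> \<omega> (cmod z) / 1"
        using True pos[of "cmod z"] pi_gt3 by (intro divide_left_mono) auto
      then show ?thesis using True by (simp add: W_def ennreal_leI)
    qed simp
  qed
  also have "\<dots> = (\<integral>\<^sup>+ z. W (cmod z) \<partial>restrict_space lborel (ball 0 1))"
    by (subst nn_integral_restrict_space) auto
  also have "\<dots> = (\<integral>\<^sup>+ r. W r \<partial>distr (restrict_space lborel (ball 0 1)) borel cmod)"
    by (subst nn_integral_distr) (auto intro: measurable_restrict_space1)
  also have "\<dots> = (\<integral>\<^sup>+ r. ennreal (indicator {0..<1} r * (2 * pi * r)) * W r \<partial>lborel)"
    unfolding distr_lborel_cmod_ball by (rule nn_integral_density) auto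
  also have "\<dots> \<le> (\<integral>\<^sup>+ r. ennreal (2 * pi) * W r \<partial>lborel)"
    by (intro nn_integral_mono mult_right_mono ennreal_leI) (auto simp: indicator_def)
  also have "\<dots> = ennreal (2 * pi) * (\<integral>\<^sup>+ r. W r \<partial>lborel)" by (rule nn_integral_cmult) auto
  also have "\<dots> < \<infinity>" using Wfin by (simp add: ennreal_mult_less_top)
  finally show ?thesis by (simp add: H_space_def holomorphic_on_ident)
qed

section \<open>Interior estimates and passage to norms\<close>

text \<open>On a small disc about z the weight is at least a positive minimum c, so the area mean
  inequality for the square of \<open>deriv f\<close> bounds its value at z by the Dirichlet
  integral.\<close>

lemma H_space_deriv_bound:
  assumes w: "admissible_weight \<omega>" and s: "0 < s" "s < 1"
  shows "\<exists>C\<ge>0. \<forall>f\<in>H_space \<omega>. \<forall>z. cmod z \<le> s \<longrightarrow> cmod (deriv f z) \<le> C * H_norm \<omega> f"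
proof -
  \<comment> \<open>Half the distance from |z| = s to the unit circle: the discs used lie in |v| < s
    + d < 1, and \<omega> attains its minimum on the compact interval
    \<open>{0..s + d}\<close>.\<close>
  define d where "d = (1 - s) / 2"
  have "d = 1 / 2 - s / 2" by (simp add: d_def diff_divide_distrib)
  then have d: "0 < d" "s + d < 1" using s by linarith+
  have "continuous_on {0..s + d} \<omega>"
  proof (rule continuous_on_subset)
    show "continuous_on {0..<1} \<omega>" using w by (simp add: admissible_weight_def)
    show "{0..s + d} \<subseteq> {0..<1}" using d by auto
  qed
  then obtain r where r: "r \<in> {0..s + d}" "\<And>x. x \<in> {0..s + d} \<Longrightarrow> \<omega> r \<le> \<omega> x"
    using continuous_attains_inf[of "{0..s + d}" \<omega>] s d by fastforce
  define c where "c = \<omega> r"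
  have "r \<in> {0..<1}" using r(1) d by auto
  then have c: "0 < c" using w unfolding c_def admissible_weight_def by blast
  define C where "C = sqrt (1 / (c * d\<^sup>2))"
  have "cmod (deriv f z) \<le> C * H_norm \<omega> f" if f: "f \<in> H_space \<omega>" and z: "cmod z \<le> s" for f z
  proof -
    have fh: "f holomorphic_on ball 0 1" and fin: "dir_integral \<omega> f < \<infinity>" using f by (auto simp: H_space_def)
    have sub: "cmod v < s + d" if "v \<in> ball z d" for v
      using that z norm_triangle_ineq[of z "v - z"] by (auto simp: dist_norm norm_minus_commute)
    let ?h = "\<lambda>v. (deriv f v)\<^sup>2"
    have h: "?h holomorphic_on ball z d"
      using sub d by (intro holomorphic_intros holomorphic_on_subset[OF holomorphic_deriv[OF fh]]) force+
    have "ennreal ((cmod (deriv f z))\<^sup>2) * ennreal (pi * d\<^sup>2)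
       = ennreal (cmod (?h z)) * emeasure lborel (ball (0::complex) d)"
      using d by (simp add: emeasure_ball unit_ball_vol_2 norm_power)
    also have "\<dots> \<le> (\<integral>\<^sup>+ v. indicator (ball z d) v * ennreal (cmod (?h v)) \<partial>lborel)"
      using d by (intro holomorphic_area_mean_ineq[OF h]) auto
    also have "\<dots> \<le> (\<integral>\<^sup>+ v. ennreal (pi / c) * (indicator (ball 0 1) v *
         ennreal ((cmod (deriv f v))\<^sup>2 * \<omega> (cmod v) / pi)) \<partial>lborel)"
    proof (rule nn_integral_mono)
      fix v
      show "indicator (ball z d) v * ennreal (cmod (?h v)) \<le> ennreal (pi / c) * (indicator (ball 0 1) v *
         ennreal ((cmod (deriv f v))\<^sup>2 * \<omega> (cmod v) / pi))"
      proof (cases "v \<in> ball z d")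
        case True
        then have v: "cmod v < 1" "c \<le> \<omega> (cmod v)" using sub[OF True] d r(2) by (auto simp: c_def)
        have "(cmod (deriv f v))\<^sup>2 * c \<le> (cmod (deriv f v))\<^sup>2 * \<omega> (cmod v)"
          using v by (intro mult_left_mono) auto
        then have "(cmod (deriv f v))\<^sup>2 \<le> pi / c * ((cmod (deriv f v))\<^sup>2 * \<omega> (cmod v) / pi)"
          using c by (simp add: field_simps)
        then have "ennreal ((cmod (deriv f v))\<^sup>2) \<le> ennreal (pi / c) * ennreal ((cmod (deriv f v))\<^sup>2 * \<omega> (cmod v) / pi)"
          using c by (simp add: ennreal_mult'[symmetric] ennreal_leI)
        then show ?thesis using True v by (simp add: norm_power)
      qed simp
    qed
    also have "\<dots> = ennreal (pi / c) * dir_integral \<omega> f"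
      unfolding dir_integral_def using borel_measurable_dir_integrand[OF w fh] by (intro nn_integral_cmult) simp
    also have "dir_integral \<omega> f = ennreal (enn2real (dir_integral \<omega> f))"
      using fin by simp
    finally have "ennreal ((cmod (deriv f z))\<^sup>2 * (pi * d\<^sup>2)) \<le> ennreal (pi / c * enn2real (dir_integral \<omega> f))"
      by (simp only: ennreal_mult'' enn2real_nonneg mult_nonneg_nonneg pi_ge_zero zero_le_power2)
    moreover have "0 \<le> pi / c * enn2real (dir_integral \<omega> f)" using c by simp
    ultimately have "(cmod (deriv f z))\<^sup>2 * (pi * d\<^sup>2) \<le> pi / c * enn2real (dir_integral \<omega> f)"
      by (simp only: ennreal_le_iff)
    then have "(cmod (deriv f z))\<^sup>2 * (pi * d\<^sup>2) / (pi * d\<^sup>2) \<le> pi / c * enn2real (dir_integral \<omega> f) / (pi * d\<^sup>2)"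
      using d by (intro divide_right_mono) auto
    then have "(cmod (deriv f z))\<^sup>2 \<le> 1 / (c * d\<^sup>2) * enn2real (dir_integral \<omega> f)"
      using d by simp
    also have "\<dots> \<le> 1 / (c * d\<^sup>2) * (H_norm \<omega> f)\<^sup>2"
      using c by (intro mult_left_mono) (auto simp: H_norm_power2)
    also have "\<dots> = (C * H_norm \<omega> f)\<^sup>2" using c by (simp add: C_def power_mult_distrib)
    finally show ?thesis by (rule power2_le_imp_le) (use c in \<open>simp add: C_def H_norm_nonneg\<close>)
  qed
  then show ?thesis using c by (intro exI[of _ C]) (auto simp: C_def)
qed

text \<open>The derivative bound is integrated from 0 over a segment of length at most 1; the
  summand 1 in the constant accounts for the value at 0.\<close>

lemma H_space_eval_bound:
  assumes w: "admissible_weight \<omega>" and s: "0 < s" "s < 1"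
  shows "\<exists>C\<ge>0. \<forall>f\<in>H_space \<omega>. \<forall>z. cmod z \<le> s \<longrightarrow> cmod (f z) \<le> C * H_norm \<omega> f"
proof -
  obtain D where D: "0 \<le> D" "\<And>f z. f \<in> H_space \<omega> \<Longrightarrow> cmod z \<le> s \<Longrightarrow> cmod (deriv f z) \<le> D * H_norm \<omega> f"
    using H_space_deriv_bound[OF w s] by blast
  have "cmod (f z) \<le> (1 + D) * H_norm \<omega> f" if f: "f \<in> H_space \<omega>" and z: "cmod z \<le> s" for f z
  proof -
    have fh: "f holomorphic_on ball 0 1" using f by (simp add: H_space_def)
    have "cmod (f z - f 0) \<le> D * H_norm \<omega> f * cmod (z - 0)"
    proof (rule field_differentiable_bound[of "cball 0 s" f "deriv f"])
      fix x :: complex assume x: "x \<in> cball 0 s"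
      then have "(f has_field_derivative deriv f x) (at x)"
        using fh s by (intro holomorphic_derivI[of f "ball 0 1"]) auto
      then show "(f has_field_derivative deriv f x) (at x within cball 0 s)" by (rule DERIV_subset) simp
      show "cmod (deriv f x) \<le> D * H_norm \<omega> f" using D(2) f x by simp
    qed (use z s in auto)
    also have "\<dots> \<le> D * H_norm \<omega> f * 1"
      using z s D(1) by (intro mult_left_mono) (auto simp: H_norm_nonneg)
    finally have "cmod (f z - f 0) \<le> D * H_norm \<omega> f" by simp
    moreover have "cmod (f 0) \<le> H_norm \<omega> f"
      unfolding H_norm_def by (rule real_le_rsqrt) simp
    ultimately show ?thesis
      using norm_triangle_ineq[of "f 0" "f z - f 0"] by (simp add: algebra_simps)
  qed
  then show ?thesis using D(1) by (intro exI[of _ "1 + D"]) auto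
qed

text \<open>By the chain rule the derivative of the composite is at most A times that of \<phi>.
  Uniform bounds on the image thus become a norm bound, the weight being carried entirely by the
  norm of \<phi>.\<close>

lemma compose_in_H_space:
  assumes w: "admissible_weight \<omega>" and p: "\<phi> \<in> H_space \<omega>"
    and F: "F holomorphic_on S" "open S" "\<phi> ` ball 0 1 \<subseteq> S"
    and A: "\<And>z. z \<in> \<phi> ` ball 0 1 \<Longrightarrow> cmod (F z) \<le> A" "\<And>z. z \<in> \<phi> ` ball 0 1 \<Longrightarrow> cmod (deriv F z) \<le> A"
  shows "(\<lambda>z. F (\<phi> z)) \<in> H_space \<omega>" "H_norm \<omega> (\<lambda>z. F (\<phi> z)) \<le> A * (1 + H_norm \<omega> \<phi>)"
proof -
  have ph: "\<phi> holomorphic_on ball 0 1" and fin: "dir_integral \<omega> \<phi> < \<infinity>" using p by (auto simp: H_space_def)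
  have A0: "0 \<le> A" using order_trans[OF norm_ge_zero A(1)[of "\<phi> 0"]] by simp
  have h: "(\<lambda>z. F (\<phi> z)) holomorphic_on ball 0 1"
    using holomorphic_on_compose_gen[OF ph F(1,3)] by (simp add: o_def)
  have D: "dir_integral \<omega> (\<lambda>z. F (\<phi> z)) \<le> ennreal (A\<^sup>2) * dir_integral \<omega> \<phi>"
  proof (rule dir_integral_le_mult[OF w ph])
    fix z :: complex assume z: "cmod z < 1"
    have "deriv (F \<circ> \<phi>) z = deriv F (\<phi> z) * deriv \<phi> z"
      using F ph z by (intro deriv_chain holomorphic_on_imp_differentiable_at[of _ "ball 0 1"]
          holomorphic_on_imp_differentiable_at[of F S]) auto
    then show "cmod (deriv (\<lambda>z. F (\<phi> z)) z) \<le> A * cmod (deriv \<phi> z)"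
      using A(2)[of "\<phi> z"] z by (simp add: o_def norm_mult mult_right_mono)
  qed
  then show "(\<lambda>z. F (\<phi> z)) \<in> H_space \<omega>"
    using h fin by (auto simp: H_space_def ennreal_mult_less_top intro: le_less_trans)
  have "enn2real (dir_integral \<omega> (\<lambda>z. F (\<phi> z))) \<le> enn2real (ennreal (A\<^sup>2) * dir_integral \<omega> \<phi>)"
    using D fin by (intro enn2real_mono) (auto simp: ennreal_mult_less_top)
  then have "enn2real (dir_integral \<omega> (\<lambda>z. F (\<phi> z))) \<le> A\<^sup>2 * enn2real (dir_integral \<omega> \<phi>)"
    by (simp add: enn2real_mult)
  moreover have "(cmod (F (\<phi> 0)))\<^sup>2 \<le> A\<^sup>2" using A(1) by (intro power_mono) auto
  ultimately have "(H_norm \<omega> (\<lambda>z. F (\<phi> z)))\<^sup>2 \<le> A\<^sup>2 * (1 + enn2real (dir_integral \<omega> \<phi>))"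
    by (simp add: H_norm_power2 algebra_simps)
  also have "\<dots> \<le> A\<^sup>2 * (1 + H_norm \<omega> \<phi>)\<^sup>2"
    by (intro mult_left_mono) (auto simp: power2_sum H_norm_power2 H_norm_nonneg)
  also have "\<dots> = (A * (1 + H_norm \<omega> \<phi>))\<^sup>2" by (simp add: power_mult_distrib)
  finally show "H_norm \<omega> (\<lambda>z. F (\<phi> z)) \<le> A * (1 + H_norm \<omega> \<phi>)"
    by (rule power2_le_imp_le) (simp add: A0 H_norm_nonneg)
qed

text \<open>Real suprema and infima carry information only for bounded nonempty sets. Each
  competitor differs from T by a bounded operator, so its \<open>op_norm\<close> is a true supremum,
  nonnegative because of the zero function; this in turn bounds the infimum's set from
  below.\<close>

lemma approx_number_bounds:
  assumes w: "admissible_weight \<omega>" and T: "bounded_linear_op \<omega> T"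
    and R: "bounded_linear_op \<omega> R" "rank_less \<omega> R n" and B: "0 \<le> B"
    and le: "\<And>f. f \<in> H_space \<omega> \<Longrightarrow> H_norm \<omega> (\<lambda>z. T f z - R f z) \<le> B * H_norm \<omega> f"
  shows "0 \<le> approx_number \<omega> T n" "approx_number \<omega> T n \<le> B"
proof -
  let ?S = "{f \<in> H_space \<omega>. H_norm \<omega> f \<le> 1}"
  have z: "(\<lambda>z. 0) \<in> ?S" by (simp add: zero_in_H_space H_norm_zero)
  have nonneg: "0 \<le> op_norm \<omega> (\<lambda>f z. T f z - R' f z)" if R': "bounded_linear_op \<omega> R'" for R'
  proof -
    obtain M1 where M1: "\<And>f. f \<in> H_space \<omega> \<Longrightarrow> H_norm \<omega> (T f) \<le> M1 * H_norm \<omega> f"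
      using T unfolding bounded_linear_op_def by blast
    obtain M2 where M2: "\<And>f. f \<in> H_space \<omega> \<Longrightarrow> H_norm \<omega> (R' f) \<le> M2 * H_norm \<omega> f"
      using R' unfolding bounded_linear_op_def by blast
    have "bdd_above ((\<lambda>f. H_norm \<omega> (\<lambda>z. T f z - R' f z)) ` ?S)"
    proof (rule bdd_aboveI2)
      fix f assume f: "f \<in> ?S"
      then have H: "T f \<in> H_space \<omega>" "R' f \<in> H_space \<omega>" using T R' unfolding bounded_linear_op_def by blast+
      have "M * H_norm \<omega> f \<le> \<bar>M\<bar> * 1" for M
        using f by (intro mult_mono) (auto simp: H_norm_nonneg)
      then have "H_norm \<omega> (T f) \<le> \<bar>M1\<bar>" "H_norm \<omega> (R' f) \<le> \<bar>M2\<bar>"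
        using M1[of f] M2[of f] f order_trans by fastforce+
      then show "H_norm \<omega> (\<lambda>z. T f z - R' f z) \<le> 2 * (\<bar>M1\<bar> + \<bar>M2\<bar>)"
        using H_norm_diff_le[OF w H] by simp
    qed
    from cSUP_upper2[OF this z, of 0] show ?thesis
      unfolding op_norm_def by (simp add: H_norm_nonneg)
  qed
  let ?A = "{op_norm \<omega> (\<lambda>f z. T f z - R f z) |R. bounded_linear_op \<omega> R \<and> rank_less \<omega> R n}"
  have mem: "op_norm \<omega> (\<lambda>f z. T f z - R f z) \<in> ?A" using R by blast
  show "0 \<le> approx_number \<omega> T n"
    unfolding approx_number_def by (rule cInf_greatest) (use mem nonneg in auto)
  have "op_norm \<omega> (\<lambda>f z. T f z - R f z) \<le> B"
    unfolding op_norm_def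
  proof (rule cSUP_least)
    fix f assume f: "f \<in> ?S"
    then have "H_norm \<omega> (\<lambda>z. T f z - R f z) \<le> B * H_norm \<omega> f" by (intro le) simp
    also have "\<dots> \<le> B * 1" using f B by (intro mult_left_mono) auto
    finally show "H_norm \<omega> (\<lambda>z. T f z - R f z) \<le> B" by simp
  qed (use z in blast)
  moreover have "approx_number \<omega> T n \<le> op_norm \<omega> (\<lambda>f z. T f z - R f z)"
    unfolding approx_number_def by (rule cInf_lower[OF mem]) (use nonneg in \<open>auto intro!: bdd_belowI[of _ 0]\<close>)
  ultimately show "approx_number \<omega> T n \<le> B" by linarith
qed

section \<open>Interpolation at the zeros of a Blaschke product\<close>

text \<open>The Blaschke factor with zero w for the disc of radius s; for s = 1 its modulus is the
  pseudo-hyperbolic distance.\<close>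

definition disc_factor :: "real \<Rightarrow> complex \<Rightarrow> complex \<Rightarrow> complex" where
  "disc_factor s w z = of_real s * (z - w) / (of_real (s\<^sup>2) - cnj w * z)"

text \<open>Up to normalisation, the Malmquist-Takenaka functions of the disc of radius s. They make
  sense for repeated zeros, as powers of a Blaschke product demand.\<close>

definition interp_basis :: "real \<Rightarrow> (nat \<Rightarrow> complex) \<Rightarrow> nat \<Rightarrow> complex \<Rightarrow> complex" where
  "interp_basis s w j z = (\<Prod>i<j. disc_factor s (w i) z) / (of_real (s\<^sup>2) - cnj (w j) * z)"

text \<open>The \<zeta>-factor of the j-th rank one term of the Cauchy kernel. Its product has one
  factor more than that of \<open>interp_basis\<close>, since splitting off term j divides by the
  j-th Blaschke factor at \<zeta>.\<close>

definition interp_weight :: "real \<Rightarrow> (nat \<Rightarrow> complex) \<Rightarrow> nat \<Rightarrow> complex \<Rightarrow> complex" where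
  "interp_weight s w j \<zeta> = of_real s * (of_real (s\<^sup>2) - cnj (w j) * w j) /
     ((of_real (s\<^sup>2) - cnj (w j) * \<zeta>) * (\<Prod>i<Suc j. disc_factor s (w i) \<zeta>))"

definition interp_coeff :: "real \<Rightarrow> (nat \<Rightarrow> complex) \<Rightarrow> nat \<Rightarrow> (complex \<Rightarrow> complex) \<Rightarrow> complex" where
  "interp_coeff s w j f = contour_integral (circlepath 0 s) (\<lambda>\<zeta>. f \<zeta> * interp_weight s w j \<zeta>) / (2 * of_real pi * \<i>)"

text \<open>For nonzero w the pole s^2 / cnj w has modulus greater than 1. Asking |w| < s^2 instead
  of |w| < s makes the basis functions holomorphic on the whole unit disc and not only inside the
  circle of integration.\<close>

lemma disc_factor_denom_nonzero:
  assumes "cmod w < s\<^sup>2" "cmod z \<le> 1"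
  shows "of_real (s\<^sup>2) - cnj w * z \<noteq> 0"
proof
  assume "of_real (s\<^sup>2) - cnj w * z = 0"
  then have "cmod (cnj w * z) = cmod (of_real (s\<^sup>2))" by simp
  then have "cmod w * cmod z = s\<^sup>2" by (simp only: norm_mult complex_mod_cnj norm_of_real abs_power2)
  then show False using assms mult_left_mono[of "cmod z" 1 "cmod w"] by simp
qed

text \<open>On the circle s^2 = \<zeta> cnj \<zeta>, so the denominator is \<zeta> cnj (\<zeta> -
  w), whose modulus s |\<zeta> - w| is that of the numerator.\<close>

lemma cmod_disc_factor_circle:
  assumes "0 < s" "s < 1" "cmod w < s\<^sup>2" "cmod \<zeta> = s"
  shows "cmod (disc_factor s w \<zeta>) = 1"
proof -
  have "of_real (s\<^sup>2) = \<zeta> * cnj \<zeta>" using complex_norm_square[of \<zeta>] assms(4) by simp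
  then have "of_real (s\<^sup>2) - cnj w * \<zeta> = \<zeta> * cnj (\<zeta> - w)" by (simp add: algebra_simps)
  then have "cmod (of_real (s\<^sup>2) - cnj w * \<zeta>) = s * cmod (\<zeta> - w)"
    using assms(4) by (simp only: norm_mult complex_mod_cnj)
  moreover have "s * s < s * 1" using assms(1,2) by (intro mult_strict_left_mono)
  then have "\<zeta> \<noteq> w" using assms by (auto simp: power2_eq_square)
  ultimately show ?thesis
    using assms(1) by (simp add: disc_factor_def norm_divide norm_mult del: of_real_power)
qed

text \<open>The interpolation formula rests on the numerator of a difference of two Blaschke factors
  being a multiple of \<open>\<zeta> - z\<close>, so that each factor contributes a kernel of rank one.\<close>

lemma cauchy_kernel_step:
  assumes d: "of_real (s\<^sup>2) - cnj w * z \<noteq> 0" "of_real (s\<^sup>2) - cnj w * \<zeta> \<noteq> 0"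
    and b: "disc_factor s w \<zeta> \<noteq> 0" and ne: "\<zeta> \<noteq> z"
  shows "1 / (\<zeta> - z) = of_real s * (of_real (s\<^sup>2) - cnj w * w) /
     ((of_real (s\<^sup>2) - cnj w * z) * ((of_real (s\<^sup>2) - cnj w * \<zeta>) * disc_factor s w \<zeta>))
     + disc_factor s w z / disc_factor s w \<zeta> / (\<zeta> - z)"
proof -
  define S where "S = complex_of_real (s\<^sup>2)"
  define D where "D = S - cnj w * z"
  define E where "E = S - cnj w * \<zeta>"
  have DE: "D \<noteq> 0" "E \<noteq> 0" using d by (auto simp: S_def D_def E_def)
  have s0: "complex_of_real s \<noteq> 0" "\<zeta> - w \<noteq> 0" using b by (auto simp: disc_factor_def)
  have key: "(\<zeta> - w) * D - (z - w) * E = (S - cnj w * w) * (\<zeta> - z)"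
    by (simp add: D_def E_def algebra_simps)
  have bz: "disc_factor s w z = of_real s * (z - w) / D" and bzeta: "disc_factor s w \<zeta> = of_real s * (\<zeta> - w) / E"
    by (simp_all add: disc_factor_def S_def D_def E_def)
  have "of_real s * (S - cnj w * w) / (D * (E * disc_factor s w \<zeta>)) = (S - cnj w * w) / (D * (\<zeta> - w))"
    using DE s0 by (simp add: bzeta)
  also have "\<dots> = (S - cnj w * w) * (\<zeta> - z) / (D * (\<zeta> - w) * (\<zeta> - z))"
    using ne by simp
  also have "\<dots> = ((\<zeta> - w) * D - (z - w) * E) / (D * (\<zeta> - w) * (\<zeta> - z))"
    by (simp only: key)
  also have "\<dots> = 1 / (\<zeta> - z) - (z - w) * E / (D * (\<zeta> - w)) / (\<zeta> - z)"
    using DE s0 by (simp add: diff_divide_distrib)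
  also have "(z - w) * E / (D * (\<zeta> - w)) = disc_factor s w z / disc_factor s w \<zeta>"
    using DE s0 by (simp add: bz bzeta)
  finally show ?thesis by (simp add: S_def D_def E_def)
qed

text \<open>Telescoping: the one-factor identity is applied again to the 1 / (\<zeta> - z) in the
  remainder, multiplied by the quotient of products accumulated so far.\<close>

lemma cauchy_kernel_expansion:
  assumes s: "0 < s" "s < 1" and w: "\<And>i. cmod (w i) < s\<^sup>2" and z: "cmod z < s" and zeta: "cmod \<zeta> = s"
  shows "1 / (\<zeta> - z) = (\<Sum>j<n. interp_basis s w j z * interp_weight s w j \<zeta>)
     + (\<Prod>i<n. disc_factor s (w i) z) / (\<Prod>i<n. disc_factor s (w i) \<zeta>) / (\<zeta> - z)"
proof (induction n)
  case (Suc n)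
  let ?P = "(\<Prod>i<n. disc_factor s (w i) z) / (\<Prod>i<n. disc_factor s (w i) \<zeta>)"
  have b: "disc_factor s (w i) \<zeta> \<noteq> 0" for i
    using cmod_disc_factor_circle[OF s w zeta, of i] by auto
  have "1 / (\<zeta> - z) = of_real s * (of_real (s\<^sup>2) - cnj (w n) * w n) /
     ((of_real (s\<^sup>2) - cnj (w n) * z) * ((of_real (s\<^sup>2) - cnj (w n) * \<zeta>) * disc_factor s (w n) \<zeta>))
     + disc_factor s (w n) z / disc_factor s (w n) \<zeta> / (\<zeta> - z)" (is "_ = ?k + ?r")
    using z zeta s by (intro cauchy_kernel_step disc_factor_denom_nonzero w b) auto
  then have "?P * (1 / (\<zeta> - z)) = ?P * ?k + ?P * ?r" by (simp only: distrib_left)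
  then have "?P / (\<zeta> - z) = ?P * ?k + ?P * ?r" by (simp only: times_divide_eq_right mult_1_right)
  moreover have "?P * ?k = interp_basis s w n z * interp_weight s w n \<zeta>"
    by (simp add: interp_basis_def interp_weight_def mult_ac)
  ultimately show ?case using Suc.IH by (simp add: mult_ac)
qed simp

lemma continuous_on_interp_weight:
  assumes s: "0 < s" "s < 1" and w: "\<And>i. cmod (w i) < s\<^sup>2"
  shows "continuous_on (sphere 0 s) (interp_weight s w j)"
proof -
  have d: "of_real (s\<^sup>2) - cnj (w i) * z \<noteq> 0" if "z \<in> sphere 0 s" for i z
    using that s by (intro disc_factor_denom_nonzero w) auto
  have c: "continuous_on (sphere 0 s) (disc_factor s (w i))" for i
    unfolding disc_factor_def using d by (intro continuous_intros) auto
  have b: "disc_factor s (w i) z \<noteq> 0" if "z \<in> sphere 0 s" for i z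
    using cmod_disc_factor_circle[OF s w, of z i] that by auto
  show ?thesis
    unfolding interp_weight_def using d b
    by (intro continuous_intros c) (auto simp: prod_zero_iff simp del: prod.lessThan_Suc)
qed

lemma interp_integrand_integrable:
  assumes s: "0 < s" "s < 1" and w: "\<And>i. cmod (w i) < s\<^sup>2" and f: "f holomorphic_on ball 0 1"
  shows "(\<lambda>\<zeta>. f \<zeta> * interp_weight s w j \<zeta>) contour_integrable_on circlepath 0 s"
proof (rule contour_integrable_continuous_circlepath)
  have "continuous_on (sphere 0 s) f"
    using s by (intro continuous_on_subset[OF holomorphic_on_imp_continuous_on[OF f]]) auto
  then show "continuous_on (path_image (circlepath 0 s)) (\<lambda>\<zeta>. f \<zeta> * interp_weight s w j \<zeta>)"
    using s continuous_on_interp_weight[of s w j, OF s w] by (auto intro: continuous_on_mult)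
qed

lemma interp_coeff_add:
  assumes "0 < s" "s < 1" "\<And>i. cmod (w i) < s\<^sup>2" "f holomorphic_on ball 0 1" "g holomorphic_on ball 0 1"
  shows "interp_coeff s w j (\<lambda>z. f z + g z) = interp_coeff s w j f + interp_coeff s w j g"
  using contour_integral_add[OF interp_integrand_integrable[of s w f j, OF assms(1-4)]
      interp_integrand_integrable[of s w g j, OF assms(1-3,5)]]
  by (simp add: interp_coeff_def distrib_right add_divide_distrib)

lemma interp_coeff_cmult:
  assumes "0 < s" "s < 1" "\<And>i. cmod (w i) < s\<^sup>2" "f holomorphic_on ball 0 1"
  shows "interp_coeff s w j (\<lambda>z. c * f z) = c * interp_coeff s w j f"
  using contour_integral_lmul[OF interp_integrand_integrable[of s w f j, OF assms], of c]
  by (simp add: interp_coeff_def mult.assoc)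

lemma interp_basis_holomorphic:
  assumes w: "\<And>i. cmod (w i) < s\<^sup>2"
  shows "interp_basis s w j holomorphic_on ball 0 1"
proof -
  have "of_real (s\<^sup>2) - cnj (w i) * z \<noteq> 0" if "z \<in> ball 0 1" for i z
    using that by (intro disc_factor_denom_nonzero w) auto
  then show ?thesis
    unfolding interp_basis_def disc_factor_def by (intro holomorphic_intros) auto
qed

text \<open>Integrating the kernel expansion against f leaves only the remainder. There the product
  at \<zeta> has modulus 1 and |\<zeta> - z| >= s - |z|; the length 2 pi s of the circle, divided by
  2 pi, leaves s.\<close>

lemma interp_error_bound:
  assumes s: "0 < s" "s < 1" and w: "\<And>i. cmod (w i) < s\<^sup>2" and f: "f holomorphic_on ball 0 1"
    and z: "cmod z < s" and M: "\<And>\<zeta>. cmod \<zeta> = s \<Longrightarrow> cmod (f \<zeta>) \<le> M"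
  shows "cmod (f z - (\<Sum>j<n. interp_coeff s w j f * interp_basis s w j z))
     \<le> (\<Prod>i<n. cmod (disc_factor s (w i) z)) * M * s / (s - cmod z)"
proof -
  let ?c = "2 * of_real pi * \<i>"
  let ?B = "M * (\<Prod>i<n. cmod (disc_factor s (w i) z)) / (s - cmod z)"
  have M0: "0 \<le> M" using order_trans[OF norm_ge_zero M[of "of_real s"]] s by simp
  have "((\<lambda>\<zeta>. f \<zeta> / (\<zeta> - z)) has_contour_integral ?c * f z) (circlepath 0 s)"
    using s z by (intro Cauchy_integral_circlepath holomorphic_on_imp_continuous_on holomorphic_on_subset[OF f]) auto
  moreover have "((\<lambda>\<zeta>. \<Sum>j<n. interp_basis s w j z * (f \<zeta> * interp_weight s w j \<zeta>)) has_contour_integral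
      (\<Sum>j<n. interp_basis s w j z * (?c * interp_coeff s w j f))) (circlepath 0 s)"
    using has_contour_integral_integral[OF interp_integrand_integrable[where w=w, OF s w f]]
    by (intro has_contour_integral_sum has_contour_integral_lmul) (auto simp: interp_coeff_def)
  ultimately have "((\<lambda>\<zeta>. f \<zeta> / (\<zeta> - z) - (\<Sum>j<n. interp_basis s w j z * (f \<zeta> * interp_weight s w j \<zeta>)))
      has_contour_integral ?c * f z - (\<Sum>j<n. interp_basis s w j z * (?c * interp_coeff s w j f))) (circlepath 0 s)"
    by (rule has_contour_integral_diff)
  then have "cmod (?c * f z - (\<Sum>j<n. interp_basis s w j z * (?c * interp_coeff s w j f))) \<le> ?B * (2 * pi * s)"
  proof (rule has_contour_integral_bound_circlepath)
    show "0 \<le> ?B" using M0 z by (intro divide_nonneg_nonneg mult_nonneg_nonneg prod_nonneg) auto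
    fix \<zeta> :: complex assume "cmod (\<zeta> - 0) = s"
    then have zeta: "cmod \<zeta> = s" by simp
    have "f \<zeta> / (\<zeta> - z) - (\<Sum>j<n. interp_basis s w j z * (f \<zeta> * interp_weight s w j \<zeta>))
       = f \<zeta> * (1 / (\<zeta> - z) - (\<Sum>j<n. interp_basis s w j z * interp_weight s w j \<zeta>))"
      by (simp add: right_diff_distrib sum_distrib_left mult_ac)
    also have "\<dots> = f \<zeta> * ((\<Prod>i<n. disc_factor s (w i) z) / (\<Prod>i<n. disc_factor s (w i) \<zeta>) / (\<zeta> - z))"
      using cauchy_kernel_expansion[of s w z \<zeta> n, OF s w z zeta] by simp
    also have "cmod \<dots> = cmod (f \<zeta>) * (\<Prod>i<n. cmod (disc_factor s (w i) z)) / cmod (\<zeta> - z)"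
      using cmod_disc_factor_circle[OF s w zeta] by (simp add: norm_mult norm_divide prod_norm[symmetric])
    also have "\<dots> \<le> ?B"
      using M[OF zeta] M0 z zeta norm_triangle_ineq2[of \<zeta> z]
      by (intro frac_le mult_right_mono mult_nonneg_nonneg prod_nonneg) auto
    finally show "cmod (f \<zeta> / (\<zeta> - z) - (\<Sum>j<n. interp_basis s w j z * (f \<zeta> * interp_weight s w j \<zeta>))) \<le> ?B" .
  qed (use s in auto)
  moreover have "?c * f z - (\<Sum>j<n. interp_basis s w j z * (?c * interp_coeff s w j f))
      = ?c * (f z - (\<Sum>j<n. interp_coeff s w j f * interp_basis s w j z))"
    by (simp add: right_diff_distrib sum_distrib_left mult_ac)
  ultimately have "cmod (?c * (f z - (\<Sum>j<n. interp_coeff s w j f * interp_basis s w j z))) \<le> ?B * (2 * pi * s)"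
    by (simp only:)
  moreover have "cmod (?c * X) = 2 * pi * cmod X" for X
    by (simp only: norm_mult norm_of_real norm_ii norm_numeral) simp
  moreover have "B * (2 * pi * s) = 2 * pi * (B * s)" for B by simp
  ultimately have "2 * pi * cmod (f z - (\<Sum>j<n. interp_coeff s w j f * interp_basis s w j z)) \<le> 2 * pi * (?B * s)"
    by metis
  then have "cmod (f z - (\<Sum>j<n. interp_coeff s w j f * interp_basis s w j z)) \<le> ?B * s"
    by (simp only: mult_le_cancel_left_pos pi_gt_zero mult_pos_pos zero_less_numeral)
  then show ?thesis by (simp add: mult_ac)
qed

section \<open>Approximation numbers\<close>

text \<open>The constant is chosen before N, n, p and q, so one C serves all powers of a Blaschke
  product. The margin d around the image turns a bound for the error into one for its
  derivative.\<close>

lemma approx_number_interp_bound: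
  assumes w: "admissible_weight \<omega>" and T: "bounded_linear_op \<omega> (comp_op \<phi>)"
    and s: "0 < s" "s < 1" and d: "0 < d" and t: "t < s"
    and sub: "\<And>v x. v \<in> \<phi> ` ball 0 1 \<Longrightarrow> x \<in> cball v d \<Longrightarrow> cmod x \<le> t"
  shows "\<exists>C\<ge>0. \<forall>N n p q. N < n \<longrightarrow> (\<forall>i. cmod (p i) < s\<^sup>2) \<longrightarrow>
     (\<forall>v\<in>\<phi> ` ball 0 1. \<forall>x\<in>cball v d. (\<Prod>i<N. cmod (disc_factor s (p i) x)) \<le> q) \<longrightarrow>
     0 \<le> approx_number \<omega> (comp_op \<phi>) n \<and> approx_number \<omega> (comp_op \<phi>) n \<le> C * q"
proof -
  have ident: "comp_op \<phi> (\<lambda>z. z) = \<phi>" by (simp add: comp_op_def o_def)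
  have TH: "comp_op \<phi> f \<in> H_space \<omega>" if "f \<in> H_space \<omega>" for f
    using T that unfolding bounded_linear_op_def by blast
  have p: "\<phi> \<in> H_space \<omega>" using TH[OF ident_in_H_space[OF w]] by (simp add: ident)
  obtain M1 where M1: "\<And>f. f \<in> H_space \<omega> \<Longrightarrow> H_norm \<omega> (comp_op \<phi> f) \<le> M1 * H_norm \<omega> f"
    using T unfolding bounded_linear_op_def by blast
  obtain Ce where Ce: "0 \<le> Ce" "\<And>f z. f \<in> H_space \<omega> \<Longrightarrow> cmod z \<le> s \<Longrightarrow> cmod (f z) \<le> Ce * H_norm \<omega> f"
    using H_space_eval_bound[OF w s] by blast
  have im: "cmod v \<le> t" if "v \<in> \<phi> ` ball 0 1" for v using sub[OF that, of v] d by simp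
  have im1: "\<phi> ` ball 0 1 \<subseteq> ball 0 1"
  proof
    fix v assume "v \<in> \<phi> ` ball 0 1"
    then have "cmod v \<le> t" by (rule im)
    then show "v \<in> ball 0 1" using t s by simp
  qed
  \<comment> \<open>The factors come in turn from evaluation on the circle and the Cauchy integral
    with |x| <= t, from Cauchy's inequality for the derivative, and from composition with
    \<phi>.\<close>
  define C where "C = Ce * s / (s - t) * (1 + 1 / d) * (1 + H_norm \<omega> \<phi>)"
  have C0: "0 \<le> C" using Ce(1) s t d by (auto simp: C_def H_norm_nonneg intro!: mult_nonneg_nonneg add_nonneg_nonneg divide_nonneg_nonneg)
  have "0 \<le> approx_number \<omega> (comp_op \<phi>) n \<and> approx_number \<omega> (comp_op \<phi>) n \<le> C * q"
    if n: "N < n" and P: "\<And>i. cmod (p i) < s\<^sup>2"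
      and q: "\<And>v x. v \<in> \<phi> ` ball 0 1 \<Longrightarrow> x \<in> cball v d \<Longrightarrow> (\<Prod>i<N. cmod (disc_factor s (p i) x)) \<le> q" for N n p q
  proof -
    define E where "E f x = f x - (\<Sum>j<N. interp_coeff s p j f * interp_basis s p j x)" for f x
    define R where "R f z = (\<Sum>j<N. interp_coeff s p j f * interp_basis s p j (\<phi> z))" for f z
    have RE: "comp_op \<phi> f z - R f z = E f (\<phi> z)" for f z by (simp add: comp_op_def R_def E_def)
    have q0: "0 \<le> q"
      using order_trans[OF prod_nonneg q[of "\<phi> 0" "\<phi> 0"]] d by simp
    have hol: "f holomorphic_on ball 0 1" if "f \<in> H_space \<omega>" for f using that by (simp add: H_space_def)
    have bh: "interp_basis s p j holomorphic_on ball 0 1" for j by (rule interp_basis_holomorphic[OF P])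
    have EH: "(\<lambda>z. E f (\<phi> z)) \<in> H_space \<omega> \<and> H_norm \<omega> (\<lambda>z. E f (\<phi> z)) \<le> C * q * H_norm \<omega> f"
      if f: "f \<in> H_space \<omega>" for f
    proof -
      define e where "e = q * (Ce * H_norm \<omega> f) * s / (s - t)"
      have e0: "0 \<le> e" using q0 Ce(1) s t by (auto simp: e_def H_norm_nonneg)
      have Eh: "E f holomorphic_on ball 0 1"
        unfolding E_def by (intro holomorphic_intros hol f bh)
      have Ee: "cmod (E f x) \<le> e" if v: "v \<in> \<phi> ` ball 0 1" and x: "x \<in> cball v d" for v x
      proof -
        have xt: "cmod x \<le> t" by (rule sub[OF v x])
        have "cmod (E f x) \<le> (\<Prod>i<N. cmod (disc_factor s (p i) x)) * (Ce * H_norm \<omega> f) * s / (s - cmod x)"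
          unfolding E_def using Ce(2)[OF f] xt t
          by (intro interp_error_bound s P hol f) auto
        also have "\<dots> \<le> e"
          unfolding e_def using q[OF v x] q0 Ce(1) s t xt
          by (intro frac_le mult_right_mono mult_nonneg_nonneg) (auto simp: H_norm_nonneg)
        finally show ?thesis .
      qed
      have E': "cmod (deriv (E f) v) \<le> e / d" if v: "v \<in> \<phi> ` ball 0 1" for v
      proof -
        have cb: "cball v d \<subseteq> ball 0 1"
        proof
          fix x assume "x \<in> cball v d"
          then have "cmod x \<le> t" by (rule sub[OF v])
          then show "x \<in> ball 0 1" using t s by simp
        qed
        have "cmod ((deriv ^^ 1) (E f) v) \<le> fact 1 * e / d ^ 1"
        proof (rule Cauchy_inequality)
          show "E f holomorphic_on ball v d"
            using cb ball_subset_cball[of v d] by (intro holomorphic_on_subset[OF Eh]) blast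
          show "continuous_on (cball v d) (E f)"
            by (rule continuous_on_subset[OF holomorphic_on_imp_continuous_on[OF Eh] cb])
          show "cmod (E f x) \<le> e" if "cmod (v - x) = d" for x
            using that by (intro Ee[OF v]) (simp add: dist_norm)
        qed (rule d)
        then show ?thesis by simp
      qed
      define A where "A = e * (1 + 1 / d)"
      have Ae: "e \<le> A" "e / d \<le> A" using e0 d by (auto simp: A_def distrib_left)
      have A: "cmod (E f z) \<le> A" "cmod (deriv (E f) z) \<le> A" if "z \<in> \<phi> ` ball 0 1" for z
        using Ee[OF that, of z] E'[OF that] Ae d by auto
      have "A * (1 + H_norm \<omega> \<phi>) = C * q * H_norm \<omega> f"
        by (simp add: A_def e_def C_def)
      then show ?thesis
        using compose_in_H_space[OF w p Eh open_ball im1 A] by simp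
    qed
    \<comment> \<open>Membership and boundedness of \<open>R f\<close> are read off from this
      difference, whose two terms are already controlled.\<close>
    have R_eq: "R f = (\<lambda>z. comp_op \<phi> f z - E f (\<phi> z))" for f
      by (rule ext) (simp add: R_def E_def comp_op_def)
    have RH: "R f \<in> H_space \<omega>" if "f \<in> H_space \<omega>" for f
      unfolding R_eq using that TH EH by (intro H_space_diff w) auto
    have Rb: "H_norm \<omega> (R f) \<le> 2 * (M1 + C * q) * H_norm \<omega> f" if f: "f \<in> H_space \<omega>" for f
    proof -
      have "H_norm \<omega> (R f) \<le> 2 * (H_norm \<omega> (comp_op \<phi> f) + H_norm \<omega> (\<lambda>z. E f (\<phi> z)))"
        unfolding R_eq using f TH EH by (intro H_norm_diff_le w) auto
      also have "\<dots> \<le> 2 * (M1 * H_norm \<omega> f + C * q * H_norm \<omega> f)"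
        using M1[OF f] EH[OF f] by (intro mult_left_mono add_mono) auto
      finally show ?thesis by (simp add: algebra_simps)
    qed
    have Rbd: "bounded_linear_op \<omega> R"
      unfolding bounded_linear_op_def
    proof (intro conjI ballI allI)
      fix f g and c :: complex assume f: "f \<in> H_space \<omega>"
      show "R f \<in> H_space \<omega>" by (rule RH[OF f])
      show "R (\<lambda>z. c * f z) = (\<lambda>z. c * R f z)"
        unfolding R_def using interp_coeff_cmult[of s p, OF s P hol[OF f]]
        by (simp add: sum_distrib_left mult.assoc)
      assume g: "g \<in> H_space \<omega>"
      show "R (\<lambda>z. f z + g z) = (\<lambda>z. R f z + R g z)"
        unfolding R_def using interp_coeff_add[of s p, OF s P hol[OF f] hol[OF g]]
        by (simp add: distrib_right sum.distrib)
    qed (use Rb in blast)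
    have Rr: "rank_less \<omega> R n"
      unfolding rank_less_def
    proof (intro exI[of _ "map (\<lambda>j z. interp_basis s p j (\<phi> z)) [0..<N]"] conjI ballI)
      \<comment> \<open>The image lies in the compact disc \<open>cball 0 t\<close>, on which a
        basis function and its derivative are bounded.\<close>
      have bH: "(\<lambda>z. interp_basis s p j (\<phi> z)) \<in> H_space \<omega>" for j
      proof -
        have cb: "cball 0 t \<subseteq> ball (0::complex) 1" using t s by auto
        have "continuous_on (cball 0 t) (interp_basis s p j)" "continuous_on (cball 0 t) (deriv (interp_basis s p j))"
          using cb by (auto intro!: holomorphic_on_imp_continuous_on holomorphic_on_subset[OF bh]
              holomorphic_on_subset[OF holomorphic_deriv[OF bh]])
        then have "bounded (interp_basis s p j ` cball 0 t)" "bounded (deriv (interp_basis s p j) ` cball 0 t)"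
          by (simp_all add: compact_imp_bounded compact_continuous_image)
        then obtain B1 B2 where B: "\<And>x. x \<in> cball 0 t \<Longrightarrow> cmod (interp_basis s p j x) \<le> B1"
          "\<And>x. x \<in> cball 0 t \<Longrightarrow> cmod (deriv (interp_basis s p j) x) \<le> B2"
          unfolding bounded_iff by (metis imageI)
        show ?thesis
        proof (rule compose_in_H_space(1)[OF w p bh open_ball im1, where A="max B1 B2"])
          fix z assume z: "z \<in> \<phi> ` ball 0 1"
          have "z \<in> cball 0 t" using im[OF z] by simp
          then show "cmod (interp_basis s p j z) \<le> max B1 B2" "cmod (deriv (interp_basis s p j) z) \<le> max B1 B2"
            using B[of z] by auto
        qed
      qed
      then show "set (map (\<lambda>j z. interp_basis s p j (\<phi> z)) [0..<N]) \<subseteq> H_space \<omega>" by auto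
      fix f
      show "\<exists>c. R f = (\<lambda>z. \<Sum>i<length (map (\<lambda>j z. interp_basis s p j (\<phi> z)) [0..<N]).
          c i * (map (\<lambda>j z. interp_basis s p j (\<phi> z)) [0..<N] ! i) z)"
        by (rule exI[of _ "\<lambda>j. interp_coeff s p j f"]) (auto simp: R_def intro!: ext sum.cong)
    qed (use n in simp)
    have "H_norm \<omega> (\<lambda>z. comp_op \<phi> f z - R f z) \<le> C * q * H_norm \<omega> f" if "f \<in> H_space \<omega>" for f
      unfolding RE using EH[OF that] by simp
    then show ?thesis
      using approx_number_bounds[OF w T Rbd Rr, of "C * q"] C0 q0 by simp
  qed
  then show ?thesis using C0 by (intro exI[of _ C] conjI allI impI) blast+
qed

section \<open>Choice of the zeros and of the radius, and exponential decay\<close>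

text \<open>Repeating m zeros periodically realises the k-th power of a Blaschke product as a single
  product over k m zeros.\<close>

lemma prod_mod_period:
  fixes a :: "nat \<Rightarrow> 'a::comm_monoid_mult"
  shows "(\<Prod>i<k * m. a (i mod m)) = (\<Prod>i<m. a i) ^ k"
proof -
  have "(\<Prod>i<k * m. a (i mod m)) = (\<Prod>j<k. \<Prod>i = j * m..<j * m + m. a (i mod m))"
    by (rule prod.nat_group[symmetric])
  also have "\<dots> = (\<Prod>j<k. \<Prod>i<m. a i)"
  proof (rule prod.cong[OF refl])
    fix j
    have "(\<Prod>i = j * m..<j * m + m. a (i mod m)) = (\<Prod>i<m. a ((i + j * m) mod m))"
      using prod.shift_bounds_nat_ivl[of "\<lambda>i. a (i mod m)" 0 "j * m" m] by (simp add: atLeast0LessThan add.commute)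
    then show "(\<Prod>i = j * m..<j * m + m. a (i mod m)) = (\<Prod>i<m. a i)" by simp
  qed
  finally show ?thesis by simp
qed

text \<open>Passing from the unit circle to a circle of radius \<open>s < 1\<close>, on which functions of the space
  are controlled, costs nothing in the limit since the Blaschke product is fixed.\<close>

lemma exists_inner_radius:
  assumes K: "compact K" "K \<subseteq> ball 0 1" and p: "\<And>i. i < m \<Longrightarrow> p i \<in> K"
    and q: "\<And>z. z \<in> K \<Longrightarrow> (\<Prod>i<m. pseudo_hyperbolic z (p i)) < q"
  shows "\<exists>s d t. 0 < s \<and> s < 1 \<and> 0 < d \<and> t < s \<and> (\<forall>v\<in>K. cmod v < s\<^sup>2) \<and>
     (\<forall>v\<in>K. \<forall>x\<in>cball v d. cmod x \<le> t \<and> (\<Prod>i<m. cmod (disc_factor s (p i) x)) \<le> q)"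
proof -
  obtain r where r: "0 \<le> r" "r < 1" "\<And>v. v \<in> K \<Longrightarrow> cmod v \<le> r"
  proof (cases "K = {}")
    case False
    then obtain u where u: "u \<in> K" "\<And>v. v \<in> K \<Longrightarrow> cmod v \<le> cmod u"
      using continuous_attains_sup[OF K(1) _ continuous_on_norm_id] by blast
    then show ?thesis using that[of "cmod u"] K(2) by auto
  qed (use that[of 0] in auto)
  \<comment> \<open>The radius becomes a variable. On \<open>O1\<close> every zero satisfies |p i|
    <= r < s^2, so the product is jointly continuous in (s, x), and the strict inequality on the
    compact set \<open>{1} \<times> K\<close> persists at distance e.\<close>
  define O1 where "O1 = {y :: real \<times> complex. r < (fst y)\<^sup>2} \<inter> {y. cmod (snd y) < 1}"
  have O1: "open O1"
    unfolding O1_def by (intro open_Int open_Collect_less continuous_intros)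
  define \<Psi> where "\<Psi> y = (\<Prod>i<m. cmod (disc_factor (fst y) (p i) (snd y)))" for y
  have "continuous_on O1 \<Psi>"
  proof -
    have "complex_of_real ((fst y)\<^sup>2) - cnj (p i) * snd y \<noteq> 0" if "y \<in> O1" "i < m" for y i
      using that r(3)[OF p[OF that(2)]] by (intro disc_factor_denom_nonzero) (auto simp: O1_def)
    then show ?thesis unfolding \<Psi>_def disc_factor_def by (intro continuous_intros) auto
  qed
  then have op: "open (O1 \<inter> \<Psi> -` {..<q})"
    using O1 by (intro continuous_open_preimage) auto
  have "{1} \<times> K \<subseteq> O1 \<inter> \<Psi> -` {..<q}"
  proof clarify
    fix z assume z: "z \<in> K"
    have "\<Psi> (1, z) = (\<Prod>i<m. pseudo_hyperbolic z (p i))"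
      by (simp add: \<Psi>_def disc_factor_def pseudo_hyperbolic_def norm_divide)
    then show "(1, z) \<in> O1 \<inter> \<Psi> -` {..<q}"
      using q[OF z] r(3)[OF z] r(2) by (auto simp: O1_def)
  qed
  then obtain e where e: "0 < e" "(\<Union>y\<in>{1} \<times> K. cball y e) \<subseteq> O1 \<inter> \<Psi> -` {..<q}"
    using compact_subset_open_imp_cball_epsilon_subset[OF compact_Times[of "{1}" K] op] K(1) by auto
  \<comment> \<open>The bounds with e / 2 keep (s, x) within e of (1, v). The others give r + d <=
    (3 r + 1) / 4 < (3 + r) / 4 <= s, so that r + d can serve as t.\<close>
  define d where "d = min (e / 2) ((1 - r) / 4)"
  define s where "s = max (1 - e / 2) ((3 + r) / 4)"
  have d: "0 < d" "d \<le> e / 2" using e(1) r(2) by (auto simp: d_def)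
  have "d \<le> (1 - r) / 4" unfolding d_def by (rule min.cobounded2)
  then have d': "4 * d \<le> 1 - r" by simp
  have "(3 + r) / 4 \<le> s" unfolding s_def by (rule max.cobounded2)
  then have s4: "3 + r \<le> 4 * s" by simp
  then have "0 < s" using r(1) by linarith
  moreover have "s < 1" "1 - e / 2 \<le> s" using e(1) r(2) by (auto simp: s_def)
  ultimately have s: "0 < s" "s < 1" "1 - e / 2 \<le> s" .
  show ?thesis
  proof (intro exI conjI ballI)
    show "0 < s" "s < 1" "0 < d" by fact+
    show "r + d < s" using d' s4 r by linarith
    fix v assume v: "v \<in> K"
    have mem: "(s, x) \<in> O1 \<inter> \<Psi> -` {..<q}" if x: "x \<in> cball v d" for x
    proof -
      have "dist (1, v) (s, x) \<le> dist 1 s + dist v x"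
        unfolding dist_Pair_Pair by (rule sqrt_sum_squares_le_sum) auto
      also have "\<dots> \<le> e" using x d s by (auto simp: dist_real_def)
      finally show ?thesis using e(2) v by (force simp: subset_iff)
    qed
    from mem[of v] d r(3)[OF v] show "cmod v < s\<^sup>2" by (auto simp: O1_def)
    fix x assume x: "x \<in> cball v d"
    show "cmod x \<le> r + d"
      using x r(3)[OF v] norm_triangle_ineq2[of x v] by (auto simp: dist_norm norm_minus_commute)
    show "(\<Prod>i<m. cmod (disc_factor s (p i) x)) \<le> q"
      using mem[OF x] by (simp add: \<Psi>_def)
  qed
qed

lemma exists_small_blaschke_product:
  assumes K: "compact K" "K \<subseteq> ball 0 1" "K \<noteq> {}" and c: "c < 0 \<or> ennreal c < green_V K"
  shows "\<exists>m p. 0 < m \<and> (\<forall>i<m. p i \<in> K) \<and>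
    (\<forall>z\<in>K. (\<Prod>i<m. pseudo_hyperbolic z (p i)) < exp (- (real m * c)))"
proof (cases "c < 0")
  case True
  obtain k where k: "k \<in> K" using K(3) by blast
  have "pseudo_hyperbolic z k < exp (- c)" if "z \<in> K" for z
  proof -
    have "cmod z < 1" "cmod k < 1" using K(2) k that by (auto simp: subset_iff)
    then have "pseudo_hyperbolic z k < 1" by (rule pseudo_hyperbolic_less_1)
    also have "1 < exp (- c)" using True by simp
    finally show ?thesis .
  qed
  then show ?thesis using k by (intro exI[of _ 1] exI[of _ "\<lambda>_. k"]) auto
next
  case False
  then have nle: "\<not> green_V K \<le> ennreal c" and c0: "0 \<le> c" using c by auto
  have "\<not> (\<forall>m p. (\<forall>i<m. p i \<in> K) \<longrightarrow>
      (\<exists>z\<in>K. exp (- (real m * c)) \<le> (\<Prod>i<m. pseudo_hyperbolic z (p i))))"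
    using green_V_le[OF K(1,2) c0] nle by blast
  then obtain m p where p: "\<forall>i<m. p i \<in> K"
    and nex: "\<not> (\<exists>z\<in>K. exp (- (real m * c)) \<le> (\<Prod>i<m. pseudo_hyperbolic z (p i)))"
    by blast
  have less: "\<forall>z\<in>K. (\<Prod>i<m. pseudo_hyperbolic z (p i)) < exp (- (real m * c))"
    using nex by (simp add: not_le)
  \<comment> \<open>The empty product would give 1 < 1 at a point of K.\<close>
  have "m \<noteq> 0"
  proof
    assume "m = 0"
    then show False using less K(3) by auto
  qed
  then show ?thesis using p less by blast
qed

lemma approx_number_exponential_decay:
  assumes w: "admissible_weight \<omega>" and T: "bounded_linear_op \<omega> (comp_op \<phi>)"
    and K: "compact K" "K \<subseteq> ball 0 1" "\<phi> ` ball 0 1 \<subseteq> K" and c: "c < 0 \<or> ennreal c < green_V K"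
  shows "\<exists>C>0. \<forall>n>0. 0 \<le> approx_number \<omega> (comp_op \<phi>) n \<and>
     approx_number \<omega> (comp_op \<phi>) n \<le> C * exp (- (real n * c))"
proof -
  have "K \<noteq> {}" using K(3) by auto
  then obtain m p where m: "0 < m" and p: "\<And>i. i < m \<Longrightarrow> p i \<in> K"
    and less: "\<And>z. z \<in> K \<Longrightarrow> (\<Prod>i<m. pseudo_hyperbolic z (p i)) < exp (- (real m * c))"
    using exists_small_blaschke_product[OF K(1,2) _ c] by blast
  obtain s d t where s: "0 < s" "s < 1" "0 < d" "t < s" and Ks: "\<And>v. v \<in> K \<Longrightarrow> cmod v < s\<^sup>2"
    and Kt: "\<And>v x. v \<in> K \<Longrightarrow> x \<in> cball v d \<Longrightarrow> cmod x \<le> t"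
    and Kq: "\<And>v x. v \<in> K \<Longrightarrow> x \<in> cball v d \<Longrightarrow> (\<Prod>i<m. cmod (disc_factor s (p i) x)) \<le> exp (- (real m * c))"
    using exists_inner_radius[of K m p "exp (- (real m * c))", OF K(1,2) p less] by blast
  have "\<exists>C\<ge>0. \<forall>N n p q. N < n \<longrightarrow> (\<forall>i. cmod (p i) < s\<^sup>2) \<longrightarrow>
     (\<forall>v\<in>\<phi> ` ball 0 1. \<forall>x\<in>cball v d. (\<Prod>i<N. cmod (disc_factor s (p i) x)) \<le> q) \<longrightarrow>
     0 \<le> approx_number \<omega> (comp_op \<phi>) n \<and> approx_number \<omega> (comp_op \<phi>) n \<le> C * q"
  proof (rule approx_number_interp_bound[OF w T s])
    fix v x assume "v \<in> \<phi> ` ball 0 1" "x \<in> cball v d"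
    then show "cmod x \<le> t" using Kt K(3) by blast
  qed
  then obtain C where C: "0 \<le> C" and bound: "\<And>N n p q. N < n \<Longrightarrow> (\<forall>i. cmod (p i) < s\<^sup>2) \<Longrightarrow>
     (\<forall>v\<in>\<phi> ` ball 0 1. \<forall>x\<in>cball v d. (\<Prod>i<N. cmod (disc_factor s (p i) x)) \<le> q) \<Longrightarrow>
     0 \<le> approx_number \<omega> (comp_op \<phi>) n \<and> approx_number \<omega> (comp_op \<phi>) n \<le> C * q"
    by blast
  \<comment> \<open>Replacing k m by n changes the exponent by at most m |c|, whatever the sign of
    c; the summand 1 keeps the constant positive even if C = 0.\<close>
  define C' where "C' = C * exp (\<bar>c\<bar> * real m) + 1"
  have "0 \<le> approx_number \<omega> (comp_op \<phi>) n \<and> approx_number \<omega> (comp_op \<phi>) n \<le> C' * exp (- (real n * c))"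
    if n: "0 < n" for n
  proof -
    \<comment> \<open>The product k m is the largest multiple of m not exceeding n - 1, as the rank
      must be less than n.\<close>
    define k where "k = (n - 1) div m"
    have km: "k * m < n" using n div_times_less_eq_dividend[of "n - 1" m] unfolding k_def by linarith
    have "n - 1 < k * m + m"
      unfolding k_def using dividend_less_div_times[OF m, of "n - 1"] by (simp add: add.commute)
    then have nk: "n \<le> k * m + m" by linarith
    have ap: "0 \<le> approx_number \<omega> (comp_op \<phi>) n \<and> approx_number \<omega> (comp_op \<phi>) n \<le> C * exp (- (real m * c)) ^ k"
    proof (rule bound[OF km, of "\<lambda>i. p (i mod m)"], intro allI, goal_cases)
      case (1 i)
      show "cmod (p (i mod m)) < s\<^sup>2" using m by (intro Ks p) simp
    next
      case 2
      show ?case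
      proof (intro ballI)
      fix v x assume v: "v \<in> \<phi> ` ball 0 1" and x: "x \<in> cball v d"
      have "(\<Prod>i<k * m. cmod (disc_factor s (p (i mod m)) x)) = (\<Prod>i<m. cmod (disc_factor s (p i) x)) ^ k"
        by (rule prod_mod_period)
      also have "\<dots> \<le> exp (- (real m * c)) ^ k"
        using v x K(3) by (intro power_mono Kq prod_nonneg) auto
      finally show "(\<Prod>i<k * m. cmod (disc_factor s (p (i mod m)) x)) \<le> exp (- (real m * c)) ^ k" .
      qed
    qed
    have "exp (- (real m * c)) ^ k = exp (- (real (k * m) * c))"
      by (simp add: exp_of_nat_mult[symmetric] mult_ac)
    also have "\<dots> \<le> exp (\<bar>c\<bar> * real m + - (real n * c))"
    proof -
      have "(real n - real (k * m)) * c \<le> real m * \<bar>c\<bar>"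
      proof -
        have "real (k * m) \<le> real n" using km by (simp only: of_nat_le_iff less_imp_le)
        moreover have "real n \<le> real (k * m) + real m"
          using nk by (simp only: of_nat_add[symmetric] of_nat_le_iff)
        ultimately have "(real n - real (k * m)) * c \<le> (real n - real (k * m)) * \<bar>c\<bar>"
          "(real n - real (k * m)) * \<bar>c\<bar> \<le> real m * \<bar>c\<bar>"
          by (auto intro!: mult_left_mono mult_right_mono)
        then show ?thesis by linarith
      qed
      then show ?thesis by (simp add: algebra_simps)
    qed
    also have "\<dots> = exp (\<bar>c\<bar> * real m) * exp (- (real n * c))" by (rule exp_add)
    finally have "C * exp (- (real m * c)) ^ k \<le> C * (exp (\<bar>c\<bar> * real m) * exp (- (real n * c)))"
      using C by (rule mult_left_mono)
    also have "\<dots> \<le> C' * exp (- (real n * c))" by (simp add: C'_def distrib_right)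
    finally show ?thesis using ap by auto
  qed
  moreover have "0 < C'" using C by (simp add: C'_def add_nonneg_pos)
  ultimately show ?thesis by blast
qed

text \<open>The constant disappears because \<open>C powr (1 / real n)\<close> tends to
  \<open>C powr 0\<close>, which is 1 as C > 0.\<close>

lemma limsup_root_le_exp:
  fixes a :: "nat \<Rightarrow> real"
  assumes C: "0 < C" and a: "\<And>n. 0 < n \<Longrightarrow> 0 \<le> a n \<and> a n \<le> C * exp (- (real n * c))"
  shows "limsup (\<lambda>n. ereal (a n powr (1 / real n))) \<le> ereal (exp (- c))"
proof -
  have "limsup (\<lambda>n. ereal (a n powr (1 / real n))) \<le> limsup (\<lambda>n. ereal (C powr (1 / real n) * exp (- c)))"
  proof (rule Limsup_mono)
    show "\<forall>\<^sub>F n in sequentially. ereal (a n powr (1 / real n)) \<le> ereal (C powr (1 / real n) * exp (- c))"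
      using eventually_gt_at_top[of 0]
    proof eventually_elim
      case (elim n)
      have "a n powr (1 / real n) \<le> (C * exp (- (real n * c))) powr (1 / real n)"
        using a[OF elim] by (intro powr_mono2) auto
      also have "\<dots> = C powr (1 / real n) * exp (- c)"
        using C elim by (simp add: powr_mult) (simp add: powr_def)
      finally show ?case by simp
    qed
  qed
  also have "\<dots> = ereal (exp (- c))"
  proof (rule lim_imp_Limsup)
    have "(\<lambda>n. C powr (1 / real n)) \<longlonglongrightarrow> C powr 0"
      using C by (intro tendsto_powr tendsto_const lim_1_over_n) auto
    from tendsto_mult[OF this tendsto_const[of "exp (- c)"]]
    show "(\<lambda>n. ereal (C powr (1 / real n) * exp (- c))) \<longlonglongrightarrow> ereal (exp (- c))"
      using C by simp
  qed simp
  finally show ?thesis .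
qed

theorem theorem3p7:
  fixes \<omega> :: "real \<Rightarrow> real" and \<phi> :: "complex \<Rightarrow> complex"
  assumes "admissible_weight \<omega>"
    and "\<phi> holomorphic_on ball 0 1" and "\<phi> ` ball 0 1 \<subseteq> ball 0 1"
    and "bounded_linear_op \<omega> (comp_op \<phi>)"
    and "(SUP z \<in> ball 0 1. cmod (\<phi> z)) < 1"
  shows "limsup (\<lambda>n. ereal (approx_number \<omega> (comp_op \<phi>) n powr (1 / real n)))
           \<le> ereal (exp_neg_inv_cap (closure (\<phi> ` ball 0 1)))"
proof -
  define K where "K = closure (\<phi> ` ball 0 1)"
  define r where "r = (SUP z \<in> ball 0 1. cmod (\<phi> z))"
  let ?L = "limsup (\<lambda>n. ereal (approx_number \<omega> (comp_op \<phi>) n powr (1 / real n)))"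
  have "bdd_above ((\<lambda>z. cmod (\<phi> z)) ` ball 0 1)"
    using assms(3) by (intro bdd_aboveI2[of _ _ 1]) (auto simp: image_subset_iff intro: less_imp_le)
  then have "cmod (\<phi> z) \<le> r" if "z \<in> ball 0 1" for z
    unfolding r_def using that by (rule cSUP_upper[rotated])
  then have "\<phi> ` ball 0 1 \<subseteq> cball 0 r" by auto
  then have Kr: "K \<subseteq> cball 0 r" unfolding K_def by (rule closure_minimal) simp
  have K: "compact K" "K \<subseteq> ball 0 1" "\<phi> ` ball 0 1 \<subseteq> K"
  proof -
    show "compact K"
      using bounded_subset[OF bounded_cball Kr] by (simp add: compact_eq_bounded_closed K_def)
    show "K \<subseteq> ball 0 1" using Kr assms(5) by (auto simp: r_def[symmetric] subset_iff)
    show "\<phi> ` ball 0 1 \<subseteq> K" unfolding K_def by (rule closure_subset)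
  qed
  have L: "?L \<le> ereal (exp (- c))" if c: "c < 0 \<or> ennreal c < green_V K" for c
    using approx_number_exponential_decay[OF assms(1,4) K c] limsup_root_le_exp by blast
  \<comment> \<open>Double inversion is exact in the extended nonnegative reals, also at 0 and
    infinity, so the exponent is \<open>green_V K\<close> itself.\<close>
  have inv: "inverse (green_cap K) = green_V K"
  proof (cases "green_V K")
    case (real x)
    then show ?thesis by (cases "x = 0") (auto simp: green_cap_def inverse_ennreal)
  qed (simp add: green_cap_def)
  have "?L \<le> ereal (exp_neg_inv_cap K)"
  proof (cases "green_V K = \<infinity>")
    case True
    \<comment> \<open>Every real c is admissible here; taking c = n bounds the limit superior by exp
      (- n) for all n.\<close>
    have "(\<lambda>n. ereal (exp (- real n))) \<longlonglongrightarrow> ereal 0"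
      by (intro tendsto_intros filterlim_compose[OF exp_at_bot] filterlim_compose[OF filterlim_uminus_at_bot_at_top] filterlim_real_sequentially)
    then have "?L \<le> ereal 0"
      by (rule LIMSEQ_le_const) (use L True in \<open>auto simp: less_top[symmetric]\<close>)
    then show ?thesis using True by (simp add: exp_neg_inv_cap_def inv)
  next
    case False
    define v where "v = enn2real (green_V K)"
    have V: "green_V K = ennreal v" using False by (simp add: v_def less_top)
    \<comment> \<open>Here c tends to v from below, and for v = 0 all these c are negative. With n
      in place of \<open>Suc n\<close> the term n = 0 would have c = v, since 1 / 0 is 0.\<close>
    have "(\<lambda>n. ereal (exp (- (v - 1 / real (Suc n))))) \<longlonglongrightarrow> ereal (exp (- (v - 0)))"
      by (intro tendsto_intros LIMSEQ_Suc[OF lim_1_over_n])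
    then have "?L \<le> ereal (exp (- (v - 0)))"
    proof (rule LIMSEQ_le_const, intro exI[of _ 0] allI impI)
      fix n :: nat
      show "?L \<le> ereal (exp (- (v - 1 / real (Suc n))))"
      proof (rule L)
        show "v - 1 / real (Suc n) < 0 \<or> ennreal (v - 1 / real (Suc n)) < green_V K"
        proof (cases "v - 1 / real (Suc n) < 0")
          case False
          moreover have "0 < 1 / real (Suc n)" by simp
          ultimately have "0 < v" "v - 1 / real (Suc n) < v" by linarith+
          then show ?thesis unfolding V by (intro disjI2 ennreal_lessI)
        qed simp
      qed
    qed
    then show ?thesis using False by (simp add: exp_neg_inv_cap_def inv v_def)
  qed
  then show ?thesis by (simp add: K_def)
qed

end
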